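(* Let $\ell>0$, $T>0$, $\sigma\in\mathbb{C}\setminus\{0\}$, $p,q\in C^1[0,\ell]$, $a\in C^2[0,\ell]$ with $a(x)>0$ on $[0,\ell]$. Let $b\in C^3[0,\ell]$ be such that the set of zeros of $b$ on $[0,\ell]$ is a finite set and each zero is of order at most one. Let $u,\widetilde u\in C^{1,2}([0,T]\times[0,\ell])$ satisfy $$\sigma\partial_t u(t,x)=a(x)\partial_x^2u(t,x)-p(x)u(t,x),\qquad \sigma\partial_t\widetilde u(t,x)=a(x)\partial_x^2\widetilde u(t,x)-q(x)\widetilde u(t,x)$$ for $0<t<T$, $0<x<\ell$, and $$u(0,\cdot)=\widetilde u(0,\cdot)=b\quad\text{in }(0,\ell).$$ Assume that $u(t,0)=\widetilde u(t,0)$ and $\partial_xu(t,0)=\partial_x\widetilde u(t,0)$ for $0<t<T$. Then $p=q$ on $[0,\ell]$ in each of the following two cases: Case A: $\partial_xu(t,0)=\partial_x\widetilde u(t,0)=0$ for $0<t<T$. Case B: there exists $\varepsilon\in(0,\ell)$ such that $p=q$ on $[0,\varepsilon]$. Moreover, the same conclusion (in each of Cases A and B) holds if the condition $u(0,\cdot)=\widetilde u(0,\cdot)=b$ in $(0,\ell)$ is replaced by $u(T,\cdot)=\widetilde u(T,\cdot)=b$ in $(0,\ell)$.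
   Context: Functions are complex-valued in general; the condition $a(x)>0$ means that $a$ is real-valued and positive. $C^{1,2}([0,T]\times[0,\ell])$ denotes the functions $u(t,x)$ such that $u,\partial_tu,\partial_xu,\partial_x^2u$ are continuous on $[0,T]\times[0,\ell]$. A zero $x_0\in[0,\ell]$ of $b$ is of order at most one if $b(x_0)=0$ and $b'(x_0)\neq0$. The set of zeros of $b$ may be empty. *)

theory Defs
  imports "HOL-Analysis.Analysis"
begin

text \<open>
  Derivatives are taken within the set \<open>S\<close>, so on a compact interval they are one-sided at the
  endpoints. The notion is meant for nondegenerate intervals \<open>S\<close>: at an isolated point of \<open>S\<close> the
  value of \<^const>\<open>vector_derivative\<close> is unspecified.
\<close>

fun C_k_on :: "nat \<Rightarrow> (real \<Rightarrow> 'a::real_normed_vector) \<Rightarrow> real set \<Rightarrow> bool" where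
  "C_k_on 0 f S \<longleftrightarrow> continuous_on S f"
| "C_k_on (Suc k) f S \<longleftrightarrow>
     (\<forall>x\<in>S. f differentiable (at x within S)) \<and>
     C_k_on k (\<lambda>x. vector_derivative f (at x within S)) S"

text \<open>
  A function \<open>u(t,x)\<close> is curried, time first. Its partial derivatives are one-sided at the boundary
  of the rectangle: \<open>S\<close> is the time interval in \<open>partial_t\<close> and the space interval in \<open>partial_x\<close>.
\<close>

definition partial_t ::
  "real set \<Rightarrow> (real \<Rightarrow> real \<Rightarrow> complex) \<Rightarrow> real \<Rightarrow> real \<Rightarrow> complex" where
  "partial_t S u t x = vector_derivative (\<lambda>s. u s x) (at t within S)"

definition partial_x ::
  "real set \<Rightarrow> (real \<Rightarrow> real \<Rightarrow> complex) \<Rightarrow> real \<Rightarrow> real \<Rightarrow> complex" where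
  "partial_x S u t x = vector_derivative (\<lambda>y. u t y) (at x within S)"

definition C_1_2_on ::
  "real set \<Rightarrow> real set \<Rightarrow> (real \<Rightarrow> real \<Rightarrow> complex) \<Rightarrow> bool" where
  "C_1_2_on I J u \<longleftrightarrow>
     (\<forall>t\<in>I. \<forall>x\<in>J.
        (\<lambda>s. u s x) differentiable (at t within I) \<and>
        (\<lambda>y. u t y) differentiable (at x within J) \<and>
        (\<lambda>y. partial_x J u t y) differentiable (at x within J)) \<and>
     continuous_on (I \<times> J) (\<lambda>(t, x). u t x) \<and>
     continuous_on (I \<times> J) (\<lambda>(t, x). partial_t I u t x) \<and>
     continuous_on (I \<times> J) (\<lambda>(t, x). partial_x J u t x) \<and>
     continuous_on (I \<times> J) (\<lambda>(t, x). partial_x J (partial_x J u) t x)"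

end

theory Submission
  imports Defs
begin

text \<open>
  Write the equation in the travel-time coordinate \<open>s\<close> with \<open>x' = \<surd>a\<close> and divide the solution by
  \<open>a\<^sup>1\<^sup>/\<^sup>4\<close>. This Liouville transformation turns \<open>a u\<^sub>x\<^sub>x - p u\<close> into \<open>U\<^sub>x\<^sub>x - P U\<close>, where \<open>P\<close> differs from \<open>p\<close> by a
  continuous term that depends on \<open>a\<close> alone, so it suffices to treat \<open>a = 1\<close>
  (\<open>potentials_eq_unit_speed\<close>). The condition \<open>u\<^sub>x(t,0) = 0\<close> becomes a Robin condition
  \<open>U\<^sub>x(t,0) = \<beta> U(t,0)\<close> with \<open>\<beta>\<close> proportional to \<open>a'(0)\<close>.

  Let \<open>f = Q - P\<close>. Both solutions have the same Cauchy data on \<open>x = 0\<close>, so each is determined by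
  these data and its own potential, and the two are linked by a transformation operator
  \<open>V = U + \<integral>\<^sub>0\<^sup>x K(x,y) U(t,y) dy\<close>. In the characteristic coordinates \<open>\<xi> = (x + y)/2\<close>,
  \<open>\<eta> = (x - y)/2\<close> the kernel solves \<open>k\<^sub>\<xi>\<^sub>\<eta> = (Q(x) - P(y)) k\<close> with \<open>2 k\<^sub>\<xi> = f\<close> on the diagonal \<open>x = y\<close> and a
  Robin condition at \<open>y = 0\<close>. This problem amounts to a Volterra equation, which a Neumann series solves
  (\<open>volterra_solution_exists\<close>), and the solution obeys \<open>|k| \<le> C sup |\<integral>f|\<close> on every square \<open>[0,m]\<^sup>2\<close>
  (\<open>norm_k_le\<close>). In particular \<open>k\<close> vanishes on \<open>[0,m]\<^sup>2\<close> if \<open>f\<close> vanishes on \<open>[0,m]\<close>.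

  The potentials are only continuous after the Liouville transformation, so \<open>k\<close> has no second
  derivatives apart from \<open>k\<^sub>\<xi>\<^sub>\<eta>\<close>. It still holds that the transform of a twice differentiable function is
  twice differentiable (\<open>transform_eq_prim_prim\<close>): a derivative in \<open>x\<close> can be taken along \<open>\<xi>\<close> with \<open>\<eta>\<close>
  fixed or along \<open>\<eta>\<close> with \<open>\<xi>\<close> fixed, and each derivative of \<open>k\<close> that occurs is of an available kind.
  Hence \<open>Z = V - U - \<integral>K U\<close> solves \<open>\<sigma> Z\<^sub>t = Z\<^sub>x\<^sub>x - Q Z\<close> with zero Cauchy data on \<open>x = 0\<close>, as long as the
  boundary terms at \<open>y = 0\<close> vanish. They do so for all \<open>x\<close> under the Robin condition, and for
  \<open>x \<le> 2 x\<^sub>0\<close> if \<open>f = 0\<close> on \<open>[0,x\<^sub>0]\<close>, because then \<open>k = 0\<close> there.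

  Such a \<open>Z\<close> vanishes for every complex \<open>\<sigma>\<close> (\<open>lateral_uniqueness\<close>), a Holmgren type theorem. Replace
  \<open>Z\<close> by its \<open>N\<close>-fold moving average in time with steps \<open>\<delta>/N\<close>. Integrating the equation twice in \<open>x\<close>
  costs one time derivative, which the average turns into a difference quotient of size \<open>2N/\<delta>\<close>, and
  gains a factorial: after \<open>N\<close> rounds the average is at most \<open>C\<^sup>N N\<^sup>N/(2N)!\<close>, which tends to \<open>0\<close> for
  fixed \<open>\<delta>\<close>, while it differs from \<open>Z\<close> only by the oscillation of \<open>Z\<close> over time \<open>\<delta>\<close>.

  At the time \<open>t\<^sub>0\<close> (\<open>0\<close> or \<open>T\<close>) where \<open>U = V\<close>, the integral \<open>\<integral>K U\<close> vanishes for all \<open>x\<close>; its second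
  derivative gives \<open>f(x) U(t\<^sub>0,x) = - \<integral>K e dy\<close> with a bounded \<open>e\<close> (\<open>initial_integral_equation\<close>). Suppose
  \<open>f = 0\<close> up to \<open>x\<^sub>0\<close>. Then \<open>K(x,\<cdot>)\<close> lives on an interval of length \<open>2(x - x\<^sub>0)\<close> and is bounded by
  \<open>C (x - x\<^sub>0) sup|f|\<close>, so the right-hand side is \<open>O((x - x\<^sub>0)\<^sup>2) sup|f|\<close>. The zeros of \<open>U(t\<^sub>0,\<cdot>)\<close> are simple,
  so the left-hand side is at least \<open>c (x - x\<^sub>0) |f(x)|\<close>. Near \<open>x\<^sub>0\<close> this forces \<open>f = 0\<close>
  (\<open>continuation_step\<close>), and \<open>f = 0\<close> on the whole interval follows by continuation.
\<close>

section \<open>Oriented primitives\<close>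

text \<open>
  Scaling to the fixed interval \<open>[0,1]\<close> makes this \<open>\<integral>\<^sub>0\<^sup>x f\<close> for either sign of \<open>x\<close>, and continuity in
  parameters that also enter the limit of integration is inherited from integrals over \<open>[0,1]\<close>.
\<close>

definition prim :: "(real \<Rightarrow> 'a::banach) \<Rightarrow> real \<Rightarrow> 'a" where
  "prim f x = x *\<^sub>R integral {0..1} (\<lambda>s. f (s * x))"

lemma continuous_on_comp:
  "continuous_on UNIV f \<Longrightarrow> continuous_on A g \<Longrightarrow> continuous_on A (\<lambda>x. f (g x))"
  using continuous_on_compose2 [of UNIV f A g] by simp

lemma continuous_on_comp2:
  "continuous_on UNIV (\<lambda>q. f (fst q) (snd q)) \<Longrightarrow> continuous_on A g \<Longrightarrow> continuous_on A h \<Longrightarrow>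
    continuous_on A (\<lambda>x. f (g x) (h x))"
  using continuous_on_compose2 [of UNIV "\<lambda>q. f (fst q) (snd q)" A "\<lambda>x. (g x, h x)"]
  by (simp add: continuous_on_Pair)

lemma prim_0 [simp]: "prim f 0 = 0"
  by (simp add: prim_def)

lemma prim_zero_fun [simp]: "prim (\<lambda>x. 0) x = 0"
  by (simp add: prim_def)

lemma continuous_on_prim [continuous_intros]:
  fixes f :: "'b::topological_space \<Rightarrow> real \<Rightarrow> 'a::banach"
  assumes f: "continuous_on (A \<times> UNIV) (\<lambda>q. f (fst q) (snd q))" and g: "continuous_on A g"
  shows "continuous_on A (\<lambda>p. prim (f p) (g p))"
proof -
  have "continuous_on (A \<times> cbox 0 1) (\<lambda>q. f (fst q) (snd q * g (fst q)))"
  proof (rule continuous_on_compose2 [OF f, where f = "\<lambda>q. (fst q, snd q * g (fst q))", simplified])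
    show "continuous_on (A \<times> cbox 0 1) (\<lambda>q. (fst q, snd q * g (fst q)))"
      by (intro continuous_intros continuous_on_compose2 [OF g]) auto
  qed auto
  then have "continuous_on A (\<lambda>p. integral (cbox 0 1) (\<lambda>s. f p (s * g p)))"
    by (intro integral_continuous_on_param) (simp add: split_beta)
  then show ?thesis
    unfolding prim_def by (intro continuous_intros g) simp
qed

lemma mult_mem_segment: "s * x \<in> closed_segment 0 x" if "s \<in> {0..1}" for s x :: real
  using that by (auto simp: closed_segment_def intro!: exI [of _ s])

lemma prim_eq_diff:
  assumes F: "\<And>y. y \<in> closed_segment 0 x \<Longrightarrow>
      (F has_vector_derivative f y) (at y within closed_segment 0 x)"
  shows "prim f x = F x - F 0"
proof -
  have "((\<lambda>s. x *\<^sub>R f (s * x)) has_integral (F (1 * x) - F (0 * x))) {0..1}"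
  proof (rule fundamental_theorem_of_calculus)
    fix s :: real assume s: "s \<in> {0..1}"
    have "((F \<circ> (\<lambda>s. s * x)) has_vector_derivative x *\<^sub>R f (s * x)) (at s within {0..1})"
    proof (rule vector_diff_chain_within)
      show "((\<lambda>s. s * x) has_vector_derivative x) (at s within {0..1})"
        by (auto intro!: derivative_eq_intros)
      show "(F has_vector_derivative f (s * x)) (at (s * x) within (\<lambda>s. s * x) ` {0..1})"
        by (rule has_vector_derivative_within_subset [OF F]) (use s mult_mem_segment in auto)
    qed
    then show "((\<lambda>s. F (s * x)) has_vector_derivative x *\<^sub>R f (s * x)) (at s within {0..1})"
      by (simp add: o_def)
  qed simp
  then show ?thesis
    unfolding prim_def by (metis integral_cmul integral_unique mult_1 mult_zero_left)
qed

lemma prim_eq_diff_nonneg: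
  assumes "0 \<le> x"
    and "\<And>y. y \<in> {0..x} \<Longrightarrow> (F has_vector_derivative f y) (at y within {0..x})"
  shows "prim f x = F x - F 0"
  using assms by (intro prim_eq_diff) (simp_all add: closed_segment_eq_real_ivl)

lemma prim_eq_diff_at:
  assumes "\<And>y. (F has_vector_derivative f y) (at y)"
  shows "prim f x = F x - F 0"
  by (rule prim_eq_diff) (rule has_vector_derivative_at_within [OF assms])

lemma has_vector_derivative_prim:
  fixes f :: "real \<Rightarrow> 'a::banach"
  assumes f: "continuous_on UNIV f"
  shows "(prim f has_vector_derivative f x) (at x)"
proof -
  define r where "r = \<bar>x\<bar> + 1"
  obtain F where F: "\<And>y. y \<in> {-r..r} \<Longrightarrow> (F has_vector_derivative f y) (at y within {-r..r})"
    using antiderivative_continuous [OF continuous_on_subset [OF f]] by blast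
  have *: "prim f y = F y - F 0" if "y \<in> {-r..r}" for y
    using that
    by (intro prim_eq_diff has_vector_derivative_within_subset [OF F])
       (auto simp: closed_segment_eq_real_ivl split: if_splits)
  have x: "x \<in> {-r<..<r}" by (auto simp: r_def)
  then have "(F has_vector_derivative f x) (at x)"
    using F [of x] by (simp add: at_within_Icc_at)
  then have "((\<lambda>y. F y - F 0) has_vector_derivative f x) (at x)"
    by (auto intro!: derivative_eq_intros)
  then show ?thesis
    by (rule has_vector_derivative_transform_within_open [OF _ open_greaterThanLessThan x])
       (simp add: *)
qed

lemma has_vector_derivative_prim_comp:
  fixes f :: "real \<Rightarrow> 'a::banach"
  assumes f: "continuous_on UNIV f" and c: "(c has_real_derivative c') (at x within S)"
  shows "((\<lambda>x. prim f (c x)) has_vector_derivative c' *\<^sub>R f (c x)) (at x within S)"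
  using vector_diff_chain_within [OF _ has_vector_derivative_at_within
      [OF has_vector_derivative_prim [OF f]], of c c' x S] c
  by (simp add: o_def has_real_derivative_iff_has_vector_derivative)

lemma prim_cong:
  assumes "0 \<le> x" "\<And>y. y \<in> {0..x} \<Longrightarrow> f y = g y"
  shows "prim f x = prim g x"
proof -
  have "integral {0..1} (\<lambda>s. f (s * x)) = integral {0..1} (\<lambda>s. g (s * x))"
  proof (rule integral_cong)
    fix s :: real assume "s \<in> {0..1}"
    then have "s * x \<in> {0..x}" using assms(1) by (auto intro: mult_left_le_one_le)
    then show "f (s * x) = g (s * x)" by (rule assms(2))
  qed
  then show ?thesis by (simp add: prim_def)
qed

lemma integrable_prim: "continuous_on UNIV f \<Longrightarrow> (\<lambda>s. f (s * x)) integrable_on {0..1}"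
  for f :: "real \<Rightarrow> 'a::banach"
  by (rule integrable_continuous_real, rule continuous_on_comp [of f]) (simp, intro continuous_intros)

lemma prim_add:
  "continuous_on UNIV f \<Longrightarrow> continuous_on UNIV g \<Longrightarrow>
    prim (\<lambda>x. f x + g x) x = prim f x + prim g x"
  using integral_add [OF integrable_prim integrable_prim, of f g x x]
  by (simp add: prim_def scaleR_add_right)

lemma prim_diff:
  "continuous_on UNIV f \<Longrightarrow> continuous_on UNIV g \<Longrightarrow>
    prim (\<lambda>x. f x - g x) x = prim f x - prim g x"
  using integral_diff [OF integrable_prim integrable_prim, of f g x x]
  by (simp add: prim_def scaleR_diff_right)

lemma prim_mult_left: "prim (\<lambda>x. c * f x) x = c * prim f x" for c :: complex
  by (simp add: prim_def)

text \<open>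
  A primitive \<open>\<Phi>\<close> of a majorant of \<open>|f|\<close> bounds the primitive of \<open>f\<close>; the choices of \<open>\<Phi>\<close> below are
  linear functions, exponentials and powers.
\<close>

lemma norm_prim_le:
  fixes f :: "real \<Rightarrow> 'a::banach"
  assumes x: "0 \<le> x" and f: "continuous_on UNIV f"
    and \<Phi>: "\<And>y. y \<in> {0..x} \<Longrightarrow> (\<Phi> has_real_derivative \<phi> y) (at y within {0..x})"
    and le: "\<And>y. y \<in> {0..x} \<Longrightarrow> norm (f y) \<le> \<phi> y"
  shows "norm (prim f x) \<le> \<Phi> x - \<Phi> 0"
proof (cases "x = 0")
  case False
  have "((\<lambda>s. x * \<phi> (s * x)) has_integral (\<Phi> (1 * x) - \<Phi> (0 * x))) {0..1}"
  proof (rule fundamental_theorem_of_calculus)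
    fix s :: real assume s: "s \<in> {0..1}"
    have "((\<Phi> \<circ> (\<lambda>s. s * x)) has_vector_derivative x *\<^sub>R \<phi> (s * x)) (at s within {0..1})"
    proof (rule vector_diff_chain_within)
      show "((\<lambda>s. s * x) has_vector_derivative x) (at s within {0..1})"
        by (auto intro!: derivative_eq_intros)
      show "(\<Phi> has_vector_derivative \<phi> (s * x)) (at (s * x) within (\<lambda>s. s * x) ` {0..1})"
        unfolding has_real_derivative_iff_has_vector_derivative [symmetric]
        by (rule has_field_derivative_subset [OF \<Phi>])
           (use s x in \<open>auto intro!: mult_left_le_one_le\<close>)
    qed
    then show "((\<lambda>s. \<Phi> (s * x)) has_vector_derivative x * \<phi> (s * x)) (at s within {0..1})"
      by (simp add: o_def)
  qed simp
  then have I: "((\<lambda>s. x * \<phi> (s * x)) has_integral (\<Phi> x - \<Phi> 0)) {0..1}" by simp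
  have "norm (integral {0..1} (\<lambda>s. x *\<^sub>R f (s * x))) \<le> integral {0..1} (\<lambda>s. x * \<phi> (s * x))"
  proof (rule integral_norm_bound_integral)
    show "(\<lambda>s. x *\<^sub>R f (s * x)) integrable_on {0..1}"
      by (intro integrable_cmul integrable_prim f)
    show "norm (x *\<^sub>R f (s * x)) \<le> x * \<phi> (s * x)" if "s \<in> {0..1}" for s
      using le [of "s * x"] that x by (auto intro!: mult_left_mono mult_left_le_one_le)
  qed (use I in blast)
  then show ?thesis
    using I unfolding prim_def by (metis integral_cmul integral_unique)
qed simp

lemma norm_prim_le_const:
  fixes f :: "real \<Rightarrow> 'a::banach"
  assumes "0 \<le> x" "continuous_on UNIV f" "\<And>y. y \<in> {0..x} \<Longrightarrow> norm (f y) \<le> M"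
  shows "norm (prim f x) \<le> M * x"
  using norm_prim_le [of x f "\<lambda>y. M * y" "\<lambda>_. M"] assms by (auto intro!: derivative_eq_intros)

lemma prim_swap:
  fixes f :: "real \<Rightarrow> real \<Rightarrow> 'a::banach"
  assumes f: "continuous_on UNIV (\<lambda>q. f (fst q) (snd q))"
  shows "prim (\<lambda>\<theta>. prim (f \<theta>) x) c = prim (\<lambda>y. prim (\<lambda>\<theta>. f \<theta> y) c) x"
proof -
  have "continuous_on (cbox (0, 0) (1, 1)) (\<lambda>q. f (fst q * c) (snd q * x))"
    by (intro continuous_on_comp2 [OF f] continuous_intros)
  then show ?thesis
    unfolding prim_def
    using integral_swap_continuous [of 0 0 1 1 "\<lambda>\<theta> s. f (\<theta> * c) (s * x)"]
    by (simp add: split_beta mult.commute)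
qed

text \<open>
  Leibniz rule with a moving endpoint: both partial derivatives of \<open>(x, w) \<mapsto> \<integral>\<^sub>0\<^sup>w H(x,y) dy\<close> exist and
  the one in \<open>w\<close> is continuous, so the map is differentiable along the curve \<open>w = c x\<close>.
\<close>

lemma has_vector_derivative_prim_param:
  fixes H H' :: "real \<Rightarrow> real \<Rightarrow> 'a::banach"
  assumes H: "continuous_on UNIV (\<lambda>q. H (fst q) (snd q))"
    and H': "continuous_on UNIV (\<lambda>q. H' (fst q) (snd q))"
    and der: "\<And>x y. ((\<lambda>x. H x y) has_vector_derivative H' x y) (at x)"
    and c: "(c has_real_derivative c') (at x)"
  shows "((\<lambda>x. prim (H x) (c x)) has_vector_derivative
           (c' *\<^sub>R H x (c x) + prim (H' x) (c x))) (at x)"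
proof -
  have Hx: "continuous_on UNIV (H z)" for z
    by (intro continuous_on_comp2 [OF H] continuous_intros)
  have fx: "((\<lambda>z. prim (H z) (c x)) has_vector_derivative prim (H' x) (c x)) (at x)"
  proof -
    have "((\<lambda>z. integral (cbox 0 1) (\<lambda>s. H z (s * c x))) has_vector_derivative
        integral (cbox 0 1) (\<lambda>s. H' x (s * c x))) (at x within UNIV)"
    proof (rule leibniz_rule_vector_derivative
        [where fx = "\<lambda>z s. H' z (s * c x)" and f = "\<lambda>z s. H z (s * c x)"])
      show "(\<lambda>s. H z (s * c x)) integrable_on cbox 0 1" for z
        using integrable_prim [OF Hx] by simp
      show "continuous_on (UNIV \<times> cbox 0 1) (\<lambda>(z, s). H' z (s * c x))"
        unfolding split_beta
        by (intro continuous_on_comp2 [OF H'] continuous_intros)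
    qed (auto intro: der)
    then show ?thesis
      unfolding prim_def by (intro derivative_eq_intros) auto
  qed
  have "((\<lambda>(z, w). prim (H z) w) has_derivative
      (\<lambda>(tz, tw). tz *\<^sub>R prim (H' x) (c x) + blinfun_scaleR_left (H x (c x)) tw))
      (at (x, c x) within UNIV \<times> UNIV)"
  proof (rule has_derivative_partialsI [where fy = "\<lambda>z w. blinfun_scaleR_left (H z w)"])
    show "((\<lambda>z. prim (H z) (c x)) has_derivative (\<lambda>tz. tz *\<^sub>R prim (H' x) (c x))) (at x within UNIV)"
      using fx by (simp add: has_vector_derivative_def)
    show "(prim (H z) has_derivative blinfun_apply (blinfun_scaleR_left (H z w))) (at w within UNIV)"
      for z w
      using has_vector_derivative_prim [OF Hx, of z w]
      by (simp add: has_vector_derivative_def)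
    have "continuous_on UNIV (\<lambda>(z, w). blinfun_scaleR_left (H z w))"
      unfolding split_beta by (intro continuous_intros H)
    then show "continuous (at (x, c x) within UNIV \<times> UNIV) (\<lambda>(z, w). blinfun_scaleR_left (H z w))"
      by (simp add: continuous_on_eq_continuous_within)
  qed auto
  then have D: "((\<lambda>(z, w). prim (H z) w) has_derivative
      (\<lambda>(tz, tw). tz *\<^sub>R prim (H' x) (c x) + tw *\<^sub>R (H x (c x)))) (at (x, c x))"
    by simp
  have "((\<lambda>z. (z, c z)) has_derivative (\<lambda>t. (t, c' * t))) (at x)"
    using c by (auto intro!: derivative_eq_intros simp: has_field_derivative_def)
  from diff_chain_at [OF this] D
  have "((\<lambda>(z, w). prim (H z) w) \<circ> (\<lambda>z. (z, c z)) has_derivative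
     (\<lambda>(tz, tw). tz *\<^sub>R prim (H' x) (c x) + tw *\<^sub>R (H x (c x))) \<circ> (\<lambda>t. (t, c' * t))) (at x)"
    by blast
  moreover have "(\<lambda>(z, w). prim (H z) w) \<circ> (\<lambda>z. (z, c z)) = (\<lambda>z. prim (H z) (c z))"
    by (simp add: o_def)
  moreover have "(\<lambda>(tz, tw). tz *\<^sub>R prim (H' x) (c x) + tw *\<^sub>R (H x (c x))) \<circ> (\<lambda>t. (t, c' * t))
      = (\<lambda>t. t *\<^sub>R (c' *\<^sub>R H x (c x) + prim (H' x) (c x)))"
    by (simp add: o_def fun_eq_iff algebra_simps)
  ultimately show ?thesis
    unfolding has_vector_derivative_def by simp
qed

lemma prim_reflect:
  fixes f :: "real \<Rightarrow> 'a::banach"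
  assumes f: "continuous_on UNIV f"
  shows "prim (\<lambda>y. f (x - y)) c = prim f x - prim f (x - c)"
proof -
  have "prim (\<lambda>y. f (x - y)) c = - prim f (x - c) - (- prim f (x - 0))"
  proof (rule prim_eq_diff_at)
    fix y
    show "((\<lambda>c. - prim f (x - c)) has_vector_derivative f (x - y)) (at y)"
      using has_vector_derivative_minus
          [OF has_vector_derivative_prim_comp [OF f, of "\<lambda>c. x - c" "-1" y UNIV]]
      by (simp add: DERIV_diff [OF DERIV_const DERIV_ident, simplified])
  qed
  then show ?thesis by simp
qed

section \<open>A Goursat problem solved by a Neumann series\<close>

text \<open>
  Precomposition with \<open>clip L\<close> extends a function on \<open>[0,L]\<close> to the real line by its boundary values.
  Kernels, potentials and time derivatives of solutions are extended in this way, which removes every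
  domain restriction from the calculus of primitives.
\<close>

definition clip :: "real \<Rightarrow> real \<Rightarrow> real" where "clip L x = max 0 (min L x)"

lemma clip_id [simp]: "0 \<le> x \<Longrightarrow> x \<le> L \<Longrightarrow> clip L x = x"
  by (simp add: clip_def)

lemma clip_bounds: "0 \<le> L \<Longrightarrow> 0 \<le> clip L x \<and> clip L x \<le> L"
  by (simp add: clip_def)

lemma continuous_on_clip [continuous_intros]:
  "continuous_on A f \<Longrightarrow> continuous_on A (\<lambda>x. clip L (f x))"
  unfolding clip_def by (intro continuous_intros)

lemma continuous_on_compose_clip:
  assumes "continuous_on {0..L} f" "0 \<le> L" "continuous_on A g"
  shows "continuous_on A (\<lambda>x. f (clip L (g x)))"
  by (rule continuous_on_compose2 [OF assms(1) continuous_on_clip [OF assms(3)]])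
     (use assms(2) clip_bounds in auto)

text \<open>
  The growth rate \<open>\<mu>\<close> is chosen such that the integral operator below has norm at most \<open>1/2\<close> for the
  weight \<open>exp (\<mu> \<eta>)\<close> on \<open>[0,L]\<^sup>2\<close>. A weight in \<open>\<eta>\<close> alone suffices, because every term of the operator
  contains an integration in \<open>\<eta>\<close>.
\<close>

locale goursat =
  fixes L r \<mu> :: real and R :: "real \<Rightarrow> real \<Rightarrow> complex" and \<gamma> :: complex
  assumes L_nonneg: "0 \<le> L" and R_cont: "continuous_on UNIV (\<lambda>q. R (fst q) (snd q))"
    and R_le: "\<And>\<xi> \<eta>. norm (R \<xi> \<eta>) \<le> r"
    and rate: "1 + 2 * (2 * r + norm \<gamma> + 2 * L * r) \<le> \<mu>"
begin

definition flux :: "(real \<Rightarrow> real \<Rightarrow> complex) \<Rightarrow> real \<Rightarrow> real \<Rightarrow> complex" where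
  "flux k \<xi> \<eta> = prim (\<lambda>\<beta>. R \<xi> \<beta> * k \<xi> \<beta>) \<eta>"

text \<open>
  A solution of \<open>k\<^sub>\<xi>\<^sub>\<eta> = R k\<close> is recovered from \<open>k\<^sub>\<xi>\<close>, whose part depending on \<open>k\<close> is \<open>flux k\<close>, by integrating
  from the point \<open>(\<eta>,\<eta>)\<close>, where \<open>y = 0\<close>, to \<open>(\<xi>,\<eta>)\<close>. The value at \<open>(\<eta>,\<eta>)\<close> is found by
  integrating \<open>k\<^sub>\<xi> + k\<^sub>\<eta>\<close> along the diagonal, and \<open>k\<^sub>\<eta> = k\<^sub>\<xi> + \<gamma> k\<close> there is the Robin condition at \<open>y = 0\<close>.
\<close>

definition volterra :: "(real \<Rightarrow> real \<Rightarrow> complex) \<Rightarrow> real \<Rightarrow> real \<Rightarrow> complex" where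
  "volterra k \<xi> \<eta> = 2 * prim (\<lambda>\<alpha>. flux k \<alpha> \<alpha>) \<eta> + \<gamma> * prim (\<lambda>\<alpha>. k \<alpha> \<alpha>) \<eta>
     + (prim (\<lambda>\<alpha>. flux k \<alpha> \<eta>) \<xi> - prim (\<lambda>\<alpha>. flux k \<alpha> \<eta>) \<eta>)"

lemma r_nonneg: "0 \<le> r"
  using R_le [of 0 0] norm_ge_zero order_trans by blast

lemma rate_ge_1: "1 \<le> \<mu>"
proof -
  have "0 \<le> 2 * r + norm \<gamma> + 2 * L * r" using r_nonneg L_nonneg by simp
  then have "1 \<le> 1 + 2 * (2 * r + norm \<gamma> + 2 * L * r)" by simp
  then show ?thesis using rate by (rule order_trans)
qed

lemma flux_cont:
  assumes k: "continuous_on UNIV (\<lambda>q. k (fst q) (snd q))"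
    and "continuous_on A f" "continuous_on A g"
  shows "continuous_on A (\<lambda>x. flux k (f x) (g x))"
proof -
  have "continuous_on UNIV (\<lambda>q. flux k (fst q) (snd q))"
    unfolding flux_def
    by (intro continuous_intros continuous_on_comp2 [OF k] continuous_on_comp2 [OF R_cont])
  from continuous_on_comp2 [OF this] show ?thesis using assms by blast
qed

lemma volterra_cont:
  assumes k: "continuous_on UNIV (\<lambda>q. k (fst q) (snd q))"
    and "continuous_on A f" "continuous_on A g"
  shows "continuous_on A (\<lambda>x. volterra k (f x) (g x))"
proof -
  have "continuous_on UNIV (\<lambda>q. volterra k (fst q) (snd q))"
    unfolding volterra_def
    by (intro continuous_intros continuous_on_comp2 [OF k] flux_cont k)
  from continuous_on_comp2 [OF this] show ?thesis using assms by blast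
qed

lemma flux_add:
  assumes k: "continuous_on UNIV (\<lambda>q. k (fst q) (snd q))"
    and k': "continuous_on UNIV (\<lambda>q. k' (fst q) (snd q))"
  shows "flux (\<lambda>\<xi> \<eta>. k \<xi> \<eta> + k' \<xi> \<eta>) \<xi> \<eta> = flux k \<xi> \<eta> + flux k' \<xi> \<eta>"
  unfolding flux_def distrib_left
  by (intro prim_add continuous_intros continuous_on_comp2 [OF k] continuous_on_comp2 [OF k']
      continuous_on_comp2 [OF R_cont])

lemma volterra_add:
  assumes k: "continuous_on UNIV (\<lambda>q. k (fst q) (snd q))"
    and k': "continuous_on UNIV (\<lambda>q. k' (fst q) (snd q))"
  shows "volterra (\<lambda>\<xi> \<eta>. k \<xi> \<eta> + k' \<xi> \<eta>) \<xi> \<eta> = volterra k \<xi> \<eta> + volterra k' \<xi> \<eta>"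
proof -
  have "prim (\<lambda>\<alpha>. flux k \<alpha> (f \<alpha>) + flux k' \<alpha> (f \<alpha>)) x
      = prim (\<lambda>\<alpha>. flux k \<alpha> (f \<alpha>)) x + prim (\<lambda>\<alpha>. flux k' \<alpha> (f \<alpha>)) x"
    if "continuous_on UNIV f" for f x
    by (intro prim_add flux_cont k k' that continuous_intros)
  note 1 = this [OF continuous_on_id] this [OF continuous_on_const]
  have 2: "prim (\<lambda>\<alpha>. k \<alpha> \<alpha> + k' \<alpha> \<alpha>) x = prim (\<lambda>\<alpha>. k \<alpha> \<alpha>) x + prim (\<lambda>\<alpha>. k' \<alpha> \<alpha>) x" for x
    by (intro prim_add continuous_on_comp2 [OF k] continuous_on_comp2 [OF k'] continuous_intros)
  show ?thesis
    unfolding volterra_def flux_add [OF k k'] 1 2 by (simp add: algebra_simps)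
qed

lemma norm_prim_exp_le:
  fixes f :: "real \<Rightarrow> complex"
  assumes "0 \<le> x" "continuous_on UNIV f" "0 \<le> M"
    and "\<And>y. y \<in> {0..x} \<Longrightarrow> norm (f y) \<le> M * exp (\<mu> * y)"
  shows "norm (prim f x) \<le> M * exp (\<mu> * x) / \<mu>"
proof -
  have "norm (prim f x) \<le> M * exp (\<mu> * x) / \<mu> - M * exp (\<mu> * 0) / \<mu>"
  proof (rule norm_prim_le)
    show "((\<lambda>y. M * exp (\<mu> * y) / \<mu>) has_real_derivative M * exp (\<mu> * y)) (at y within {0..x})" for y
      using rate_ge_1 by (auto intro!: derivative_eq_intros)
  qed (use assms in auto)
  moreover have "0 \<le> M * exp (\<mu> * 0) / \<mu>" using assms rate_ge_1 by simp
  ultimately show ?thesis by linarith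
qed

lemma norm_flux_le:
  assumes k: "continuous_on UNIV (\<lambda>q. k (fst q) (snd q))"
    and le: "\<And>\<alpha> \<beta>. \<alpha> \<in> {0..m} \<Longrightarrow> \<beta> \<in> {0..m} \<Longrightarrow> norm (k \<alpha> \<beta>) \<le> M * exp (\<mu> * \<beta>)"
    and "0 \<le> M" "\<xi> \<in> {0..m}" "\<eta> \<in> {0..m}"
  shows "norm (flux k \<xi> \<eta>) \<le> (r * M / \<mu>) * exp (\<mu> * \<eta>)"
proof -
  have "norm (flux k \<xi> \<eta>) \<le> (r * M) * exp (\<mu> * \<eta>) / \<mu>"
    unfolding flux_def
  proof (rule norm_prim_exp_le)
    show "continuous_on UNIV (\<lambda>\<beta>. R \<xi> \<beta> * k \<xi> \<beta>)"
      by (intro continuous_intros continuous_on_comp2 [OF k] continuous_on_comp2 [OF R_cont])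
    show "norm (R \<xi> y * k \<xi> y) \<le> r * M * exp (\<mu> * y)" if "y \<in> {0..\<eta>}" for y
      using mult_mono [OF R_le [of \<xi> y] le [of \<xi> y]] assms that r_nonneg
      by (simp add: norm_mult mult.assoc)
  qed (use assms r_nonneg in auto)
  then show ?thesis by simp
qed

text \<open>
  Each term gains a factor \<open>1/\<mu>\<close> from integrating the weight in \<open>\<eta>\<close>; restricting to \<open>[0,m]\<^sup>2\<close> is
  possible because the operator only looks at arguments in that square.
\<close>

lemma norm_volterra_le:
  assumes k: "continuous_on UNIV (\<lambda>q. k (fst q) (snd q))" and m: "m \<le> L"
    and le: "\<And>\<alpha> \<beta>. \<alpha> \<in> {0..m} \<Longrightarrow> \<beta> \<in> {0..m} \<Longrightarrow> norm (k \<alpha> \<beta>) \<le> M * exp (\<mu> * \<beta>)"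
    and M: "0 \<le> M" and \<xi>: "\<xi> \<in> {0..m}" and \<eta>: "\<eta> \<in> {0..m}"
  shows "norm (volterra k \<xi> \<eta>) \<le> M / 2 * exp (\<mu> * \<eta>)"
proof -
  note l = rate_ge_1
  define E where "E = exp (\<mu> * \<eta>)"
  have E: "E > 0" by (simp add: E_def)
  note fl = norm_flux_le [OF k le M]
  have "norm (prim (\<lambda>\<alpha>. flux k \<alpha> \<alpha>) \<eta>) \<le> (r * M / \<mu>) * E / \<mu>"
    unfolding E_def
    by (intro norm_prim_exp_le flux_cont [OF k] continuous_intros fl)
       (use \<eta> M l r_nonneg in auto)
  also have "\<dots> \<le> (r * M / \<mu>) * E / 1"
    using M l r_nonneg E by (intro divide_left_mono) auto
  finally have 1: "norm (prim (\<lambda>\<alpha>. flux k \<alpha> \<alpha>) \<eta>) \<le> (r * M / \<mu>) * E" by simp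
  have 2: "norm (prim (\<lambda>\<alpha>. k \<alpha> \<alpha>) \<eta>) \<le> M * E / \<mu>"
    unfolding E_def
    by (intro norm_prim_exp_le continuous_on_comp2 [OF k] continuous_intros le)
       (use \<eta> M in auto)
  have 3: "norm (prim (\<lambda>\<alpha>. flux k \<alpha> \<eta>) x) \<le> (r * M / \<mu>) * E * L" if "x \<in> {0..m}" for x
  proof -
    have "norm (prim (\<lambda>\<alpha>. flux k \<alpha> \<eta>) x) \<le> (r * M / \<mu>) * E * x"
      unfolding E_def
      by (intro norm_prim_le_const flux_cont [OF k] continuous_intros fl)
         (use \<eta> that M in auto)
    also have "\<dots> \<le> (r * M / \<mu>) * E * L"
      using that m M l r_nonneg E by (intro mult_left_mono) auto
    finally show ?thesis .
  qed
  have "norm (volterra k \<xi> \<eta>) \<le> 2 * norm (prim (\<lambda>\<alpha>. flux k \<alpha> \<alpha>) \<eta>)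
      + norm \<gamma> * norm (prim (\<lambda>\<alpha>. k \<alpha> \<alpha>) \<eta>)
      + (norm (prim (\<lambda>\<alpha>. flux k \<alpha> \<eta>) \<xi>) + norm (prim (\<lambda>\<alpha>. flux k \<alpha> \<eta>) \<eta>))"
    unfolding volterra_def
    by (intro norm_triangle_le add_mono norm_triangle_le_diff order_refl)
       (simp_all add: norm_mult)
  also have "\<dots> \<le> 2 * ((r * M / \<mu>) * E) + norm \<gamma> * (M * E / \<mu>)
      + ((r * M / \<mu>) * E * L + (r * M / \<mu>) * E * L)"
    by (intro add_mono mult_left_mono 1 2 3 \<xi> \<eta>) auto
  also have "\<dots> = ((2 * r + norm \<gamma> + 2 * L * r) / \<mu>) * (M * E)"
    using l by (simp add: field_simps)
  also have "\<dots> \<le> (1 / 2) * (M * E)"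
    using l rate M E by (intro mult_right_mono) (auto simp: field_simps)
  finally show ?thesis by (simp add: E_def)
qed

text \<open>
  The Neumann series converges geometrically, uniformly on the plane because its terms are clipped.
  Clipping does not affect the equation on \<open>[0,L]\<^sup>2\<close>.
\<close>

lemma volterra_solution_exists:
  assumes \<psi>: "continuous_on UNIV (\<lambda>q. \<psi> (fst q) (snd q))"
  obtains k where "continuous_on UNIV (\<lambda>q. k (fst q) (snd q))"
    and "\<And>\<xi> \<eta>. k \<xi> \<eta> = \<psi> (clip L \<xi>) (clip L \<eta>) + volterra k (clip L \<xi>) (clip L \<eta>)"
proof -
  define it where "it = rec_nat (\<lambda>\<xi> \<eta>. \<psi> (clip L \<xi>) (clip L \<eta>))
    (\<lambda>_ k \<xi> \<eta>. volterra k (clip L \<xi>) (clip L \<eta>))"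
  have it_0: "it 0 \<xi> \<eta> = \<psi> (clip L \<xi>) (clip L \<eta>)"
    and it_Suc: "it (Suc n) \<xi> \<eta> = volterra (it n) (clip L \<xi>) (clip L \<eta>)" for n \<xi> \<eta>
    by (simp_all add: it_def)
  have it_cont: "continuous_on UNIV (\<lambda>q. it n (fst q) (snd q))" for n
  proof (induction n)
    case 0
    show ?case unfolding it_0 by (intro continuous_on_comp2 [OF \<psi>] continuous_intros)
  next
    case (Suc n)
    then show ?case unfolding it_Suc by (intro volterra_cont continuous_intros)
  qed
  have "compact ((\<lambda>q. \<psi> (fst q) (snd q)) ` ({0..L} \<times> {0..L}))"
    by (intro compact_continuous_image continuous_on_subset [OF \<psi>] compact_Times) auto
  then obtain M where M: "0 < M" "\<And>\<xi> \<eta>. \<xi> \<in> {0..L} \<Longrightarrow> \<eta> \<in> {0..L} \<Longrightarrow> norm (\<psi> \<xi> \<eta>) \<le> M"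
    by (force dest!: compact_imp_bounded simp: bounded_pos)
  have it_le: "norm (it n \<xi> \<eta>) \<le> M / 2 ^ n * exp (\<mu> * clip L \<eta>)" for n \<xi> \<eta>
  proof (induction n arbitrary: \<xi> \<eta>)
    case 0
    have "norm (it 0 \<xi> \<eta>) \<le> M * 1"
      using M(2) clip_bounds [OF L_nonneg] by (simp add: it_0)
    also have "\<dots> \<le> M * exp (\<mu> * clip L \<eta>)"
      using M(1) rate_ge_1 clip_bounds [OF L_nonneg, of \<eta>] by (intro mult_left_mono) auto
    finally show ?case by simp
  next
    case (Suc n)
    have "norm (volterra (it n) (clip L \<xi>) (clip L \<eta>)) \<le> (M / 2 ^ n) / 2 * exp (\<mu> * clip L \<eta>)"
    proof (rule norm_volterra_le [OF it_cont order_refl])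
      show "norm (it n \<alpha> \<beta>) \<le> M / 2 ^ n * exp (\<mu> * \<beta>)" if "\<beta> \<in> {0..L}" for \<alpha> \<beta>
        using Suc.IH [of \<alpha> \<beta>] that by simp
    qed (use M clip_bounds [OF L_nonneg] in auto)
    then show ?case by (simp add: it_Suc field_simps)
  qed
  define C where "C = M * exp (\<mu> * L)"
  have C: "C > 0" using M by (simp add: C_def)
  have it_le': "norm (it n \<xi> \<eta>) \<le> C * (1 / 2) ^ n" for n \<xi> \<eta>
  proof -
    have "M / 2 ^ n * exp (\<mu> * clip L \<eta>) \<le> M / 2 ^ n * exp (\<mu> * L)"
      using M clip_bounds [OF L_nonneg, of \<eta>] rate_ge_1 by (intro mult_left_mono) auto
    then show ?thesis using it_le [of n \<xi> \<eta>] by (simp add: C_def power_one_over field_simps)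
  qed
  define k where "k \<xi> \<eta> = (\<Sum>n. it n \<xi> \<eta>)" for \<xi> \<eta>
  define s where "s N \<xi> \<eta> = (\<Sum>n<N. it n \<xi> \<eta>)" for N \<xi> \<eta>
  have geo: "summable (\<lambda>n. C * (1 / 2) ^ n)"
    by (intro summable_mult summable_geometric) simp
  have s_cont: "continuous_on UNIV (\<lambda>q. s N (fst q) (snd q))" for N
    unfolding s_def by (intro continuous_intros it_cont)
  have k_cont: "continuous_on UNIV (\<lambda>q. k (fst q) (snd q))"
  proof (rule uniform_limit_theorem)
    show "uniform_limit UNIV (\<lambda>N q. s N (fst q) (snd q)) (\<lambda>q. k (fst q) (snd q)) sequentially"
      unfolding s_def k_def by (rule Weierstrass_m_test [OF _ geo]) (rule it_le')
  qed (use s_cont in auto)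
  have tail: "norm (k \<xi> \<eta> - s N \<xi> \<eta>) \<le> 2 * C * (1 / 2) ^ N" for N \<xi> \<eta>
  proof -
    have sm: "summable (\<lambda>n. it n \<xi> \<eta>)"
      by (rule summable_comparison_test [OF _ geo]) (use it_le' in auto)
    have "k \<xi> \<eta> - s N \<xi> \<eta> = (\<Sum>n. it (n + N) \<xi> \<eta>)"
      unfolding k_def s_def using suminf_split_initial_segment [OF sm, of N] by simp
    also have "norm \<dots> \<le> (\<Sum>n. C * (1 / 2) ^ N * (1 / 2) ^ n)"
    proof (rule norm_suminf_le)
      show "norm (it (n + N) \<xi> \<eta>) \<le> C * (1 / 2) ^ N * (1 / 2) ^ n" for n
        using it_le' [of "n + N" \<xi> \<eta>] by (simp add: power_add mult_ac)
    qed (intro summable_mult summable_geometric, simp)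
    also have "\<dots> = 2 * C * (1 / 2) ^ N"
      by (subst suminf_mult) (auto simp: suminf_geometric intro: summable_geometric)
    finally show ?thesis .
  qed
  have s_Suc: "s (Suc N) \<xi> \<eta> = \<psi> (clip L \<xi>) (clip L \<eta>) + volterra (s N) (clip L \<xi>) (clip L \<eta>)" for N \<xi> \<eta>
  proof (induction N)
    case 0
    have "volterra (\<lambda>\<xi> \<eta>. 0) \<alpha> \<beta> = 0" for \<alpha> \<beta> by (simp add: volterra_def flux_def)
    then show ?case by (simp add: s_def it_0)
  next
    case (Suc N)
    have "s (Suc N) = (\<lambda>\<xi> \<eta>. s N \<xi> \<eta> + it N \<xi> \<eta>)" by (simp add: s_def fun_eq_iff)
    with volterra_add [OF s_cont [of N] it_cont [of N]]
    have "volterra (s (Suc N)) \<alpha> \<beta> = volterra (s N) \<alpha> \<beta> + volterra (it N) \<alpha> \<beta>" for \<alpha> \<beta> by simp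
    moreover have "s (Suc (Suc N)) \<xi> \<eta> = s (Suc N) \<xi> \<eta> + it (Suc N) \<xi> \<eta>"
      by (simp add: s_def)
    ultimately show ?case using Suc.IH by (simp add: it_Suc)
  qed
  \<comment> \<open>by linearity, the limit in \<open>s_Suc\<close> only needs the bound on the operator applied to the tail\<close>
  have "k \<xi> \<eta> = \<psi> (clip L \<xi>) (clip L \<eta>) + volterra k (clip L \<xi>) (clip L \<eta>)" for \<xi> \<eta>
  proof -
    let ?d = "k \<xi> \<eta> - (\<psi> (clip L \<xi>) (clip L \<eta>) + volterra k (clip L \<xi>) (clip L \<eta>))"
    have le: "norm ?d \<le> (2 * C + C * exp (\<mu> * L)) * (1 / 2) ^ N" for N
    proof -
      let ?e = "\<lambda>\<xi> \<eta>. k \<xi> \<eta> - s N \<xi> \<eta>"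
      have e_cont: "continuous_on UNIV (\<lambda>q. ?e (fst q) (snd q))"
        by (intro continuous_intros k_cont s_cont)
      have "volterra k \<alpha> \<beta> = volterra (s N) \<alpha> \<beta> + volterra ?e \<alpha> \<beta>" for \<alpha> \<beta>
        using volterra_add [OF s_cont [of N] e_cont] by simp
      then have "?d = (k \<xi> \<eta> - s (Suc N) \<xi> \<eta>) - volterra ?e (clip L \<xi>) (clip L \<eta>)"
        by (simp add: s_Suc)
      also have "norm \<dots> \<le> norm (k \<xi> \<eta> - s (Suc N) \<xi> \<eta>) + norm (volterra ?e (clip L \<xi>) (clip L \<eta>))"
        by (rule norm_triangle_ineq4)
      also have "norm (k \<xi> \<eta> - s (Suc N) \<xi> \<eta>) \<le> 2 * C * (1 / 2) ^ N"
        using tail [of \<xi> \<eta> "Suc N"] C by (simp add: field_simps)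
      also have "norm (volterra ?e (clip L \<xi>) (clip L \<eta>))
          \<le> (2 * C * (1 / 2) ^ N) / 2 * exp (\<mu> * clip L \<eta>)"
      proof (rule norm_volterra_le [OF e_cont order_refl])
        show "norm (?e \<alpha> \<beta>) \<le> 2 * C * (1 / 2) ^ N * exp (\<mu> * \<beta>)" if "\<beta> \<in> {0..L}" for \<alpha> \<beta>
        proof -
          have "1 \<le> exp (\<mu> * \<beta>)" using that rate_ge_1 by simp
          then have "2 * C * (1 / 2) ^ N * 1 \<le> 2 * C * (1 / 2) ^ N * exp (\<mu> * \<beta>)"
            using C by (intro mult_left_mono) auto
          then show ?thesis using tail [of \<alpha> \<beta> N] by linarith
        qed
      qed (use C clip_bounds [OF L_nonneg] in auto)
      also have "\<dots> \<le> (2 * C * (1 / 2) ^ N) / 2 * exp (\<mu> * L)"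
        using C clip_bounds [OF L_nonneg, of \<eta>] rate_ge_1 by (intro mult_left_mono) auto
      finally show ?thesis by (simp add: algebra_simps)
    qed
    have "(\<lambda>N. (2 * C + C * exp (\<mu> * L)) * (1 / 2) ^ N) \<longlonglongrightarrow> 0"
      by (intro tendsto_mult_right_zero LIMSEQ_power_zero) simp
    then have "norm ?d \<le> 0"
      by (rule LIMSEQ_le_const) (use le in blast)
    then show ?thesis by simp
  qed
  with k_cont show thesis by (rule that)
qed

text \<open>
  Where \<open>|k| exp (- \<mu> \<eta>)\<close> attains its maximum over \<open>[0,m]\<^sup>2\<close>, the integral term contributes at most half
  of this maximum, so \<open>\<psi>\<close> must account for the other half.
\<close>

lemma volterra_solution_le:
  assumes k: "continuous_on UNIV (\<lambda>q. k (fst q) (snd q))" and m: "0 \<le> m" "m \<le> L"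
    and eq: "\<And>\<xi> \<eta>. \<xi> \<in> {0..m} \<Longrightarrow> \<eta> \<in> {0..m} \<Longrightarrow> k \<xi> \<eta> = \<psi> \<xi> \<eta> + volterra k \<xi> \<eta>"
    and \<psi>: "\<And>\<xi> \<eta>. \<xi> \<in> {0..m} \<Longrightarrow> \<eta> \<in> {0..m} \<Longrightarrow> norm (\<psi> \<xi> \<eta>) \<le> S"
    and \<xi>: "\<xi> \<in> {0..m}" and \<eta>: "\<eta> \<in> {0..m}"
  shows "norm (k \<xi> \<eta>) \<le> 2 * exp (\<mu> * L) * S"
proof -
  let ?w = "\<lambda>q. norm (k (fst q) (snd q)) * exp (- \<mu> * snd q)"
  have "continuous_on ({0..m} \<times> {0..m}) ?w"
    by (intro continuous_intros continuous_on_comp2 [OF k])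
  from continuous_attains_sup [OF _ _ this] m
  obtain a b where ab: "a \<in> {0..m}" "b \<in> {0..m}"
    and max: "\<And>\<alpha> \<beta>. \<alpha> \<in> {0..m} \<Longrightarrow> \<beta> \<in> {0..m} \<Longrightarrow> ?w (\<alpha>, \<beta>) \<le> ?w (a, b)"
    by (force simp: compact_Times)
  define M where "M = ?w (a, b)"
  have M: "0 \<le> M" by (simp add: M_def)
  have le: "norm (k \<alpha> \<beta>) \<le> M * exp (\<mu> * \<beta>)" if "\<alpha> \<in> {0..m}" "\<beta> \<in> {0..m}" for \<alpha> \<beta>
    using max [OF that] by (simp add: M_def exp_minus field_simps)
  have "M * exp (\<mu> * b) = norm (k a b)" by (simp add: M_def exp_minus field_simps)
  also have "\<dots> \<le> norm (\<psi> a b) + norm (volterra k a b)"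
    using eq [OF ab] norm_triangle_ineq by metis
  also have "\<dots> \<le> S + M / 2 * exp (\<mu> * b)"
    by (intro add_mono \<psi> ab norm_volterra_le [OF k m(2) le M])
  finally have "M * exp (\<mu> * b) \<le> 2 * S" by simp
  moreover have "M * 1 \<le> M * exp (\<mu> * b)"
    using M ab rate_ge_1 by (intro mult_left_mono) auto
  ultimately have MS: "M \<le> 2 * S" by simp
  have "norm (k \<xi> \<eta>) \<le> M * exp (\<mu> * \<eta>)" by (rule le [OF \<xi> \<eta>])
  also have "\<dots> \<le> (2 * S) * exp (\<mu> * L)"
    using MS M \<eta> m rate_ge_1 by (intro mult_mono) auto
  finally show ?thesis by (simp add: mult_ac)
qed

end

section \<open>The transformation operator\<close>

lemma has_vector_derivative_comp_real:
  assumes "\<And>x. (f has_vector_derivative f' x) (at x)"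
    and "(c has_real_derivative c') (at x)"
  shows "((\<lambda>x. f (c x)) has_vector_derivative c' *\<^sub>R f' (c x)) (at x)"
  using vector_diff_chain_at [of c c' x f "f' (c x)"] assms
  by (simp add: o_def has_real_derivative_iff_has_vector_derivative)

lemma continuous_on_if_vderiv:
  "(\<And>x. (f has_vector_derivative f' x) (at x)) \<Longrightarrow> continuous_on UNIV f"
  by (meson continuous_at_imp_continuous_on has_vector_derivative_continuous)

text \<open>
  The function \<open>\<kappa>\<close> is the kernel of the transformation operator in characteristic coordinates, clipped to
  \<open>[0,L]\<^sup>2\<close>.
\<close>

locale kernel = goursat L r \<mu> "\<lambda>\<xi> \<eta>. Q (\<xi> + \<eta>) - P (\<xi> - \<eta>)" \<gamma>
  for L r \<mu> :: real and P Q :: "real \<Rightarrow> complex" and \<gamma> :: complex +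
  fixes \<kappa> :: "real \<Rightarrow> real \<Rightarrow> complex"
  assumes P_cont: "continuous_on UNIV P" and Q_cont: "continuous_on UNIV Q"
    and \<kappa>_cont: "continuous_on UNIV (\<lambda>q. \<kappa> (fst q) (snd q))"
    and \<kappa>_eq: "\<And>\<xi> \<eta>. \<kappa> \<xi> \<eta> = prim (\<lambda>y. (Q y - P y) / 2) (clip L \<xi>)
      + prim (\<lambda>y. (Q y - P y) / 2) (clip L \<eta>) + volterra \<kappa> (clip L \<xi>) (clip L \<eta>)"
begin

text \<open>
  \<open>\<kappa>\<close> need not be differentiable across the edges of \<open>[0,L]\<^sup>2\<close>. Applying the right-hand side of its equation
  without clipping gives an extension \<open>k\<close> that is differentiable on the whole plane, with
  \<open>k\<^sub>\<xi> = k\<^sub>1\<close> and \<open>k\<^sub>\<xi>\<^sub>\<eta> = \<rho>\<close>.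
\<close>

definition k :: "real \<Rightarrow> real \<Rightarrow> complex" where
  "k \<xi> \<eta> = prim (\<lambda>y. (Q y - P y) / 2) \<xi> + prim (\<lambda>y. (Q y - P y) / 2) \<eta> + volterra \<kappa> \<xi> \<eta>"

definition k\<^sub>1 :: "real \<Rightarrow> real \<Rightarrow> complex" where
  "k\<^sub>1 \<xi> \<eta> = (Q \<xi> - P \<xi>) / 2 + flux \<kappa> \<xi> \<eta>"

definition \<rho> :: "real \<Rightarrow> real \<Rightarrow> complex" where
  "\<rho> \<xi> \<eta> = (Q (\<xi> + \<eta>) - P (\<xi> - \<eta>)) * \<kappa> \<xi> \<eta>"

lemma k_eq_\<kappa>: "\<xi> \<in> {0..L} \<Longrightarrow> \<eta> \<in> {0..L} \<Longrightarrow> k \<xi> \<eta> = \<kappa> \<xi> \<eta>"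
  by (simp add: k_def \<kappa>_eq [of \<xi> \<eta>])

lemma half_diff_cont: "continuous_on UNIV (\<lambda>y. (Q y - P y) / 2)"
  by (intro continuous_intros P_cont Q_cont) simp

lemma k_cont: "continuous_on UNIV (\<lambda>q. k (fst q) (snd q))"
  unfolding k_def
  by (intro continuous_intros volterra_cont \<kappa>_cont
      continuous_on_comp [OF half_diff_cont])

lemma k\<^sub>1_cont: "continuous_on UNIV (\<lambda>q. k\<^sub>1 (fst q) (snd q))"
  unfolding k\<^sub>1_def
  by (intro continuous_on_add continuous_intros flux_cont \<kappa>_cont
      continuous_on_comp [OF half_diff_cont])

lemma \<rho>_cont: "continuous_on UNIV (\<lambda>q. \<rho> (fst q) (snd q))"
  unfolding \<rho>_def
  by (intro continuous_on_mult continuous_on_comp2 [OF R_cont] continuous_on_comp2 [OF \<kappa>_cont]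
      continuous_intros)

lemma has_vector_derivative_k: "((\<lambda>\<xi>. k \<xi> \<eta>) has_vector_derivative k\<^sub>1 \<xi> \<eta>) (at \<xi>)"
proof -
  have "continuous_on UNIV (\<lambda>\<alpha>. flux \<kappa> \<alpha> \<eta>)"
    by (intro flux_cont \<kappa>_cont continuous_intros)
  note d = has_vector_derivative_prim [OF this, of \<xi>] has_vector_derivative_prim [OF half_diff_cont, of \<xi>]
  show ?thesis
    unfolding k_def volterra_def k\<^sub>1_def
    by (rule derivative_eq_intros d refl)+ simp
qed

lemma has_vector_derivative_k\<^sub>1: "((\<lambda>\<eta>. k\<^sub>1 \<xi> \<eta>) has_vector_derivative \<rho> \<xi> \<eta>) (at \<eta>)"
proof -
  have "continuous_on UNIV (\<lambda>\<eta>. \<rho> \<xi> \<eta>)"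
    by (intro continuous_on_comp2 [OF \<rho>_cont] continuous_intros)
  note d = has_vector_derivative_prim [OF this, of \<eta>]
  show ?thesis
    unfolding k\<^sub>1_def flux_def \<rho>_def [symmetric]
    by (rule derivative_eq_intros d refl)+ simp
qed

lemma has_vector_derivative_k_diag:
  "((\<lambda>\<alpha>. k \<alpha> \<alpha>) has_vector_derivative 2 * k\<^sub>1 \<alpha> \<alpha> + \<gamma> * \<kappa> \<alpha> \<alpha>) (at \<alpha>)"
proof -
  have 1: "continuous_on UNIV (\<lambda>\<alpha>. flux \<kappa> \<alpha> \<alpha>)"
    by (intro flux_cont \<kappa>_cont continuous_intros)
  have 2: "continuous_on UNIV (\<lambda>\<alpha>. \<kappa> \<alpha> \<alpha>)"
    by (intro continuous_on_comp2 [OF \<kappa>_cont] continuous_intros)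
  note d = has_vector_derivative_prim [OF 1, of \<alpha>] has_vector_derivative_prim [OF 2, of \<alpha>]
    has_vector_derivative_prim [OF half_diff_cont, of \<alpha>]
  have "((\<lambda>\<alpha>. prim (\<lambda>y. (Q y - P y) / 2) \<alpha> + prim (\<lambda>y. (Q y - P y) / 2) \<alpha> +
      (2 * prim (\<lambda>\<alpha>. flux \<kappa> \<alpha> \<alpha>) \<alpha> + \<gamma> * prim (\<lambda>\<alpha>. \<kappa> \<alpha> \<alpha>) \<alpha>))
      has_vector_derivative ((Q \<alpha> - P \<alpha>) / 2 + (Q \<alpha> - P \<alpha>) / 2 + (2 * flux \<kappa> \<alpha> \<alpha> + \<gamma> * \<kappa> \<alpha> \<alpha>))) (at \<alpha>)"
    by (intro has_vector_derivative_add has_vector_derivative_mult_right d)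
  moreover have "(Q \<alpha> - P \<alpha>) / 2 + (Q \<alpha> - P \<alpha>) / 2 + (2 * flux \<kappa> \<alpha> \<alpha> + \<gamma> * \<kappa> \<alpha> \<alpha>)
      = 2 * k\<^sub>1 \<alpha> \<alpha> + \<gamma> * \<kappa> \<alpha> \<alpha>"
    by (simp add: k\<^sub>1_def)
  ultimately show ?thesis
    unfolding k_def volterra_def by (simp only: diff_self add_0_right)
qed

text \<open>
  This is \<open>\<integral>\<^sub>0\<^sup>x K(x,y) g(y) dy\<close> with \<open>K(x,y) = k((x + y)/2, (x - y)/2)\<close>, written in the variable
  \<open>\<eta> = (x - y)/2\<close>.
\<close>

definition transform :: "(real \<Rightarrow> complex) \<Rightarrow> real \<Rightarrow> complex" where
  "transform g x = 2 * prim (\<lambda>\<eta>. k (x - \<eta>) \<eta> * g (x - 2 * \<eta>)) (x / 2)"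

text \<open>
  With \<open>\<eta>\<close> fixed, only the \<open>\<xi>\<close>-derivative of the kernel enters.
\<close>

lemma has_vector_derivative_kernel_transform:
  assumes g: "\<And>x. (g has_vector_derivative g' x) (at x)" and g'_cont: "continuous_on UNIV g'"
  shows "(transform g has_vector_derivative
    k (x / 2) (x / 2) * g 0 +
    2 * prim (\<lambda>\<eta>. k\<^sub>1 (x - \<eta>) \<eta> * g (x - 2 * \<eta>) + k (x - \<eta>) \<eta> * g' (x - 2 * \<eta>)) (x / 2)) (at x)"
proof -
  note g_cont = continuous_on_if_vderiv [OF g]
  have "((\<lambda>x. prim (\<lambda>\<eta>. k (x - \<eta>) \<eta> * g (x - 2 * \<eta>)) (x / 2)) has_vector_derivative
    (1 / 2) *\<^sub>R (k (x - x / 2) (x / 2) * g (x - 2 * (x / 2))) +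
    prim (\<lambda>\<eta>. k\<^sub>1 (x - \<eta>) \<eta> * g (x - 2 * \<eta>) + k (x - \<eta>) \<eta> * g' (x - 2 * \<eta>)) (x / 2)) (at x)"
  proof (rule has_vector_derivative_prim_param
      [where H = "\<lambda>x \<eta>. k (x - \<eta>) \<eta> * g (x - 2 * \<eta>)"])
    show "continuous_on UNIV (\<lambda>q. k (fst q - snd q) (snd q) * g (fst q - 2 * snd q))"
      by (intro continuous_on_mult continuous_on_comp2 [OF k_cont] continuous_on_comp [OF g_cont]
          continuous_intros)
    show "continuous_on UNIV (\<lambda>q. k\<^sub>1 (fst q - snd q) (snd q) * g (fst q - 2 * snd q)
        + k (fst q - snd q) (snd q) * g' (fst q - 2 * snd q))"
      by (intro continuous_on_mult continuous_on_add continuous_on_comp2 [OF k_cont]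
          continuous_on_comp2 [OF k\<^sub>1_cont] continuous_on_comp [OF g_cont]
          continuous_on_comp [OF g'_cont] continuous_intros)
    show "((\<lambda>x. k (x - y) y * g (x - 2 * y)) has_vector_derivative
        k\<^sub>1 (x - y) y * g (x - 2 * y) + k (x - y) y * g' (x - 2 * y)) (at x)" for x y
    proof -
      have "((\<lambda>x. k (x - y) y) has_vector_derivative 1 *\<^sub>R k\<^sub>1 (x - y) y) (at x)"
        by (rule has_vector_derivative_comp_real [OF has_vector_derivative_k])
           (auto intro!: derivative_eq_intros)
      moreover have "((\<lambda>x. g (x - 2 * y)) has_vector_derivative 1 *\<^sub>R g' (x - 2 * y)) (at x)"
        by (rule has_vector_derivative_comp_real [OF g]) (auto intro!: derivative_eq_intros)
      ultimately show ?thesis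
        using has_vector_derivative_mult by (fastforce simp: add.commute)
    qed
    show "((\<lambda>x. x / 2) has_real_derivative 1 / 2) (at x)"
      by (auto intro!: derivative_eq_intros)
  qed
  from has_vector_derivative_mult_right [OF this, of 2] show ?thesis
    unfolding transform_def by (simp add: scaleR_conv_of_real algebra_simps)
qed

text \<open>
  In general \<open>k\<^sub>1\<close> has no \<open>\<xi>\<close>-derivative, since \<open>Q - P\<close> is only continuous. In the variable \<open>\<xi> = x - \<eta>\<close> the derivative in \<open>x\<close> falls on the
  second argument of \<open>k\<^sub>1\<close> instead, where it is \<open>\<rho>\<close>.
\<close>

lemma has_vector_derivative_flux_transform:
  assumes g: "\<And>x. (g has_vector_derivative g' x) (at x)" and g'_cont: "continuous_on UNIV g'"
  shows "((\<lambda>x. 2 * prim (\<lambda>\<eta>. k\<^sub>1 (x - \<eta>) \<eta> * g (x - 2 * \<eta>)) (x / 2)) has_vector_derivative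
    (Q x - P x) * g x - k\<^sub>1 (x / 2) (x / 2) * g 0 +
    2 * prim (\<lambda>\<eta>. \<rho> (x - \<eta>) \<eta> * g (x - 2 * \<eta>) - k\<^sub>1 (x - \<eta>) \<eta> * g' (x - 2 * \<eta>)) (x / 2)) (at x)"
proof -
  note g_cont = continuous_on_if_vderiv [OF g]
  define h where "h x \<xi> = k\<^sub>1 \<xi> (x - \<xi>) * g (2 * \<xi> - x)" for x \<xi>
  define h' where "h' x \<xi> = \<rho> \<xi> (x - \<xi>) * g (2 * \<xi> - x) - k\<^sub>1 \<xi> (x - \<xi>) * g' (2 * \<xi> - x)" for x \<xi>
  have h_cont: "continuous_on UNIV (\<lambda>q. h (fst q) (snd q))"
    unfolding h_def
    by (intro continuous_on_mult continuous_on_comp2 [OF k\<^sub>1_cont] continuous_on_comp [OF g_cont]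
        continuous_intros)
  have h'_cont: "continuous_on UNIV (\<lambda>q. h' (fst q) (snd q))"
    unfolding h'_def
    by (intro continuous_on_mult continuous_on_diff continuous_on_comp2 [OF \<rho>_cont]
        continuous_on_comp2 [OF k\<^sub>1_cont] continuous_on_comp [OF g_cont]
        continuous_on_comp [OF g'_cont] continuous_intros)
  have h_der: "((\<lambda>x. h x y) has_vector_derivative h' x y) (at x)" for x y
  proof -
    have "((\<lambda>x. k\<^sub>1 y (x - y)) has_vector_derivative 1 *\<^sub>R \<rho> y (x - y)) (at x)"
      by (rule has_vector_derivative_comp_real [OF has_vector_derivative_k\<^sub>1])
         (auto intro!: derivative_eq_intros)
    moreover have "((\<lambda>x. g (2 * y - x)) has_vector_derivative (- 1) *\<^sub>R g' (2 * y - x)) (at x)"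
      by (rule has_vector_derivative_comp_real [OF g]) (auto intro!: derivative_eq_intros)
    ultimately have "((\<lambda>x. k\<^sub>1 y (x - y) * g (2 * y - x)) has_vector_derivative
        k\<^sub>1 y (x - y) * ((- 1) *\<^sub>R g' (2 * y - x)) + 1 *\<^sub>R \<rho> y (x - y) * g (2 * y - x)) (at x)"
      by (rule has_vector_derivative_mult)
    then show ?thesis by (simp add: h_def h'_def algebra_simps)
  qed
  have slice: "continuous_on UNIV (F x)"
    if "continuous_on UNIV (\<lambda>q. F (fst q) (snd q))" for F :: "real \<Rightarrow> real \<Rightarrow> complex" and x
    by (intro continuous_on_comp2 [OF that] continuous_intros)
  \<comment> \<open>\<open>\<xi> = x - \<eta>\<close> ranges over \<open>[x/2, x]\<close>\<close>
  have refl: "prim (\<lambda>\<eta>. F x (x - \<eta>)) (x / 2) = prim (F x) x - prim (F x) (x / 2)"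
    if "continuous_on UNIV (\<lambda>q. F (fst q) (snd q))" for F :: "real \<Rightarrow> real \<Rightarrow> complex" and x
    using prim_reflect [OF slice [OF that], of x x "x / 2"] by simp
  have "((\<lambda>x. prim (h x) x - prim (h x) (x / 2)) has_vector_derivative
      (1 *\<^sub>R h x x + prim (h' x) x) - ((1 / 2) *\<^sub>R h x (x / 2) + prim (h' x) (x / 2))) (at x)"
    by (intro has_vector_derivative_diff has_vector_derivative_prim_param h_cont h'_cont h_der)
       (auto intro!: derivative_eq_intros)
  from has_vector_derivative_mult_right [OF this, of 2]
  have "((\<lambda>x. 2 * prim (\<lambda>\<eta>. h x (x - \<eta>)) (x / 2)) has_vector_derivative
      2 * h x x - h x (x / 2) + 2 * prim (\<lambda>\<eta>. h' x (x - \<eta>)) (x / 2)) (at x)"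
    by (simp add: refl [OF h_cont] refl [OF h'_cont] scaleR_conv_of_real algebra_simps)
  moreover have hxx: "2 * h x x = (Q x - P x) * g x"
    by (simp add: h_def k\<^sub>1_def flux_def)
  ultimately show ?thesis
    unfolding hxx by (simp add: h_def h'_def)
qed

text \<open>
  \<open>N\<close> is the second derivative of the transform. The terms with \<open>k\<^sub>1 g'\<close> arising from the two ways of
  differentiating cancel, and \<open>k\<^sub>1\<close> on the diagonal cancels by the differential equation of
  \<open>\<alpha> \<mapsto> k \<alpha> \<alpha>\<close>; the boundary terms at \<open>y = 0\<close> that remain vanish for Robin data
  \<open>g' 0 = \<beta> * g 0\<close> with \<open>\<gamma> = - 2 * \<beta>\<close>.
\<close>

lemma transform_eq_prim_prim:
  assumes g: "\<And>x. (g has_vector_derivative g' x) (at x)"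
    and g': "\<And>x. (g' has_vector_derivative g'' x) (at x)" and g''_cont: "continuous_on UNIV g''"
  defines "N \<equiv> \<lambda>x. (Q x - P x) * g x + (k (x / 2) (x / 2) * g' 0 + \<gamma> / 2 * \<kappa> (x / 2) (x / 2) * g 0)
     + 2 * prim (\<lambda>\<eta>. \<rho> (x - \<eta>) \<eta> * g (x - 2 * \<eta>) + k (x - \<eta>) \<eta> * g'' (x - 2 * \<eta>)) (x / 2)"
  shows "continuous_on UNIV N" and "transform g x = prim (prim N) x"
proof -
  note g_cont = continuous_on_if_vderiv [OF g]
  note g'_cont = continuous_on_if_vderiv [OF g']
  define A where "A x = k (x / 2) (x / 2) * g 0 +
    2 * prim (\<lambda>\<eta>. k\<^sub>1 (x - \<eta>) \<eta> * g (x - 2 * \<eta>) + k (x - \<eta>) \<eta> * g' (x - 2 * \<eta>)) (x / 2)" for x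
  have c: "continuous_on UNIV (\<lambda>\<eta>. k (x - \<eta>) \<eta> * g' (x - 2 * \<eta>))"
    "continuous_on UNIV (\<lambda>\<eta>. k\<^sub>1 (x - \<eta>) \<eta> * g (x - 2 * \<eta>))"
    "continuous_on UNIV (\<lambda>\<eta>. k (x - \<eta>) \<eta> * g'' (x - 2 * \<eta>))"
    "continuous_on UNIV (\<lambda>\<eta>. k\<^sub>1 (x - \<eta>) \<eta> * g' (x - 2 * \<eta>))"
    "continuous_on UNIV (\<lambda>\<eta>. \<rho> (x - \<eta>) \<eta> * g (x - 2 * \<eta>))" for x
    by (intro continuous_on_mult continuous_on_comp2 [OF k_cont] continuous_on_comp2 [OF k\<^sub>1_cont]
        continuous_on_comp2 [OF \<rho>_cont] continuous_on_comp [OF g_cont]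
        continuous_on_comp [OF g'_cont] continuous_on_comp [OF g''_cont] continuous_intros)+
  have A_eq: "A x = k (x / 2) (x / 2) * g 0
      + 2 * prim (\<lambda>\<eta>. k\<^sub>1 (x - \<eta>) \<eta> * g (x - 2 * \<eta>)) (x / 2) + transform g' x" for x
    unfolding A_def transform_def prim_add [OF c(2) c(1)] by (simp only: distrib_left add.assoc)
  have N_eq: "N x = (k\<^sub>1 (x / 2) (x / 2) + \<gamma> / 2 * \<kappa> (x / 2) (x / 2)) * g 0
    + ((Q x - P x) * g x - k\<^sub>1 (x / 2) (x / 2) * g 0 +
    2 * prim (\<lambda>\<eta>. \<rho> (x - \<eta>) \<eta> * g (x - 2 * \<eta>) - k\<^sub>1 (x - \<eta>) \<eta> * g' (x - 2 * \<eta>)) (x / 2))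
    + (k (x / 2) (x / 2) * g' 0 +
    2 * prim (\<lambda>\<eta>. k\<^sub>1 (x - \<eta>) \<eta> * g' (x - 2 * \<eta>) + k (x - \<eta>) \<eta> * g'' (x - 2 * \<eta>)) (x / 2))" for x
    unfolding N_def prim_add [OF c(5) c(3)] prim_diff [OF c(5) c(4)] prim_add [OF c(4) c(3)]
    by (simp only: distrib_left distrib_right right_diff_distrib) simp
  have dk: "((\<lambda>x. k (x / 2) (x / 2)) has_vector_derivative
      (1 / 2) *\<^sub>R (2 * k\<^sub>1 (x / 2) (x / 2) + \<gamma> * \<kappa> (x / 2) (x / 2))) (at x)" for x
    by (rule has_vector_derivative_comp_real [OF has_vector_derivative_k_diag])
       (auto intro!: derivative_eq_intros)
  have "(A has_vector_derivative (((1 / 2) *\<^sub>R (2 * k\<^sub>1 (x / 2) (x / 2) + \<gamma> * \<kappa> (x / 2) (x / 2))) * g 0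
    + ((Q x - P x) * g x - k\<^sub>1 (x / 2) (x / 2) * g 0 +
    2 * prim (\<lambda>\<eta>. \<rho> (x - \<eta>) \<eta> * g (x - 2 * \<eta>) - k\<^sub>1 (x - \<eta>) \<eta> * g' (x - 2 * \<eta>)) (x / 2))
    + (k (x / 2) (x / 2) * g' 0 +
    2 * prim (\<lambda>\<eta>. k\<^sub>1 (x - \<eta>) \<eta> * g' (x - 2 * \<eta>) + k (x - \<eta>) \<eta> * g'' (x - 2 * \<eta>)) (x / 2)))) (at x)" for x
    unfolding A_eq
    by (intro has_vector_derivative_add has_vector_derivative_mult_left dk
        has_vector_derivative_flux_transform g g' has_vector_derivative_kernel_transform g'_cont g''_cont)
  then have A: "(A has_vector_derivative N x) (at x)" for x
    unfolding N_eq by (simp add: scaleR_conv_of_real algebra_simps)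
  have T: "(transform g has_vector_derivative A x) (at x)" for x
    unfolding A_def by (rule has_vector_derivative_kernel_transform [OF g g'_cont])
  show "continuous_on UNIV N"
    unfolding N_def
    by (intro continuous_on_add continuous_on_mult continuous_on_comp2 [OF k_cont]
        continuous_on_comp2 [OF \<kappa>_cont]
        continuous_on_comp2 [OF \<rho>_cont] continuous_on_comp [OF g_cont] P_cont Q_cont
        continuous_on_comp [OF g''_cont] continuous_intros) auto
  have "k 0 0 = 0" by (simp add: k_def volterra_def)
  then have "A 0 = 0" by (simp add: A_def)
  then have "prim N = A" using prim_eq_diff_at [OF A] by (simp add: fun_eq_iff)
  then show "transform g x = prim (prim N) x"
    using prim_eq_diff_at [OF T, of x] by (simp add: transform_def)
qed

text \<open>
  Only the primitive of \<open>Q - P\<close> enters: the kernel vanishes where the potentials have agreed so far, and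
  grows at most linearly in the distance from there.
\<close>

lemma norm_k_le:
  assumes m: "0 \<le> m" "m \<le> L"
    and S: "\<And>y. y \<in> {0..m} \<Longrightarrow> norm (prim (\<lambda>y. (Q y - P y) / 2) y) \<le> S"
    and "\<xi> \<in> {0..m}" "\<eta> \<in> {0..m}"
  shows "norm (k \<xi> \<eta>) \<le> 4 * exp (\<mu> * L) * S"
proof -
  have "norm (\<kappa> \<xi> \<eta>) \<le> 2 * exp (\<mu> * L) * (2 * S)"
  proof (rule volterra_solution_le [OF \<kappa>_cont m _ _ assms(4,5)])
    fix \<xi> \<eta> assume "\<xi> \<in> {0..m}" "\<eta> \<in> {0..m}"
    then show "\<kappa> \<xi> \<eta> = (prim (\<lambda>y. (Q y - P y) / 2) \<xi> + prim (\<lambda>y. (Q y - P y) / 2) \<eta>) + volterra \<kappa> \<xi> \<eta>"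
      and "norm (prim (\<lambda>y. (Q y - P y) / 2) \<xi> + prim (\<lambda>y. (Q y - P y) / 2) \<eta>) \<le> 2 * S"
      using \<kappa>_eq [of \<xi> \<eta>] m S norm_triangle_mono [OF S S, of \<xi> \<eta>] by auto
  qed
  then show ?thesis using assms k_eq_\<kappa> [of \<xi> \<eta>] by simp
qed

end

section \<open>Uniqueness from Cauchy data on the lateral boundary\<close>

definition time_average :: "real \<Rightarrow> (real \<Rightarrow> real \<Rightarrow> complex) \<Rightarrow> real \<Rightarrow> real \<Rightarrow> complex" where
  "time_average h Z t x = prim (\<lambda>\<theta>. Z (t + h * \<theta>) x) 1"

definition time_quotient :: "real \<Rightarrow> (real \<Rightarrow> real \<Rightarrow> complex) \<Rightarrow> real \<Rightarrow> real \<Rightarrow> complex" where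
  "time_quotient h Z t x = (Z (t + h) x - Z t x) / of_real h"

definition joint_cont :: "(real \<Rightarrow> real \<Rightarrow> complex) \<Rightarrow> bool" where
  "joint_cont Z \<longleftrightarrow> continuous_on UNIV (\<lambda>q. Z (fst q) (snd q))"

lemma joint_contD: "joint_cont Z \<Longrightarrow> continuous_on A f \<Longrightarrow> continuous_on A g \<Longrightarrow> continuous_on A (\<lambda>x. Z (f x) (g x))"
  unfolding joint_cont_def by (rule continuous_on_comp2)

lemma joint_cont_time_average: "joint_cont Z \<Longrightarrow> joint_cont (time_average h Z)"
  unfolding joint_cont_def [of "time_average h Z"] time_average_def by (intro continuous_intros joint_contD)

lemma joint_cont_time_quotient: "joint_cont Z \<Longrightarrow> joint_cont (time_quotient h Z)"
  unfolding joint_cont_def [of "time_quotient h Z"] time_quotient_def divide_inverse by (intro continuous_intros joint_contD)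

lemma joint_cont_time_average_pow: "joint_cont Z \<Longrightarrow> joint_cont ((time_average h ^^ n) Z)"
  by (induction n) (auto intro: joint_cont_time_average)

lemma joint_cont_time_quotient_pow: "joint_cont Z \<Longrightarrow> joint_cont ((time_quotient h ^^ n) Z)"
  by (induction n) (auto intro: joint_cont_time_quotient)

lemma time_quotient_time_average_commute:
  assumes Z: "joint_cont Z"
  shows "time_quotient h (time_average h Z) = time_average h (time_quotient h Z)"
proof (intro ext)
  fix t x
  have "prim (\<lambda>\<theta>. inverse (of_real h) * (Z (t + h * \<theta> + h) x - Z (t + h * \<theta>) x)) 1
      = inverse (of_real h) * (prim (\<lambda>\<theta>. Z (t + h * \<theta> + h) x) 1 - prim (\<lambda>\<theta>. Z (t + h * \<theta>) x) 1)"
    unfolding prim_mult_left by (subst prim_diff) (intro joint_contD [OF Z] continuous_intros refl)+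
  then show "time_quotient h (time_average h Z) t x = time_average h (time_quotient h Z) t x"
    unfolding time_quotient_def time_average_def by (simp add: divide_inverse mult.commute add_ac)
qed

lemma time_quotient_pow_time_average_commute:
  "joint_cont Z \<Longrightarrow> (time_quotient h ^^ j) (time_average h Z) = time_average h ((time_quotient h ^^ j) Z)"
  by (induction j) (simp_all add: time_quotient_time_average_commute joint_cont_time_quotient_pow)

lemma norm_time_average_le:
  assumes Z: "joint_cont Z" and h: "0 \<le> h" and le: "\<And>s. s \<in> {t..t + h} \<Longrightarrow> norm (Z s x - c) \<le> B"
  shows "norm (time_average h Z t x - c) \<le> B"
proof -
  have "prim (\<lambda>\<theta>. Z (t + h * \<theta>) x - c) 1 = time_average h Z t x - prim (\<lambda>_. c) 1"
    unfolding time_average_def by (intro prim_diff joint_contD [OF Z] continuous_intros)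
  also have "prim (\<lambda>_. c) 1 = c" by (simp add: prim_def)
  finally have "norm (time_average h Z t x - c) = norm (prim (\<lambda>\<theta>. Z (t + h * \<theta>) x - c) 1)" by simp
  also have "\<dots> \<le> B * 1"
  proof (rule norm_prim_le_const)
    show "continuous_on UNIV (\<lambda>\<theta>. Z (t + h * \<theta>) x - c)"
      by (intro joint_contD [OF Z] continuous_intros)
    show "norm (Z (t + h * y) x - c) \<le> B" if "y \<in> {0..1}" for y
      using that h by (intro le) (auto intro!: mult_left_le)
  qed simp
  finally show ?thesis by simp
qed

lemma norm_time_average_pow_le:
  assumes Z: "joint_cont Z" and h: "0 \<le> h"
    and le: "\<And>s. s \<in> {t..t + \<delta>} \<Longrightarrow> norm (Z s x - c) \<le> B" and s: "s \<in> {t..t + \<delta> - n * h}"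
  shows "norm ((time_average h ^^ n) Z s x - c) \<le> B"
  using s
proof (induction n arbitrary: s)
  case 0
  then show ?case using le by simp
next
  case (Suc n)
  have "norm (time_average h ((time_average h ^^ n) Z) s x - c) \<le> B"
    using Suc by (intro norm_time_average_le joint_cont_time_average_pow Z h Suc.IH) (auto simp: algebra_simps)
  then show ?case by simp
qed

lemma norm_time_quotient_pow_le:
  assumes h: "0 < h" and le: "\<And>s. s \<in> {0..T} \<Longrightarrow> norm (Z s x) \<le> M" and s: "s \<in> {0..T - j * h}"
  shows "norm ((time_quotient h ^^ j) Z s x) \<le> M * (2 / h) ^ j"
  using s
proof (induction j arbitrary: s)
  case 0
  then show ?case using le by simp
next
  case (Suc j)
  let ?D = "(time_quotient h ^^ j) Z"
  have "norm (?D (s + h) x - ?D s x) \<le> M * (2 / h) ^ j + M * (2 / h) ^ j"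
    using Suc.prems h by (intro norm_triangle_le_diff add_mono Suc.IH) (auto simp: algebra_simps)
  then have "norm (?D (s + h) x - ?D s x) / h \<le> (M * (2 / h) ^ j + M * (2 / h) ^ j) / h"
    using h by (intro divide_right_mono) auto
  also have "norm (?D (s + h) x - ?D s x) / h = norm (time_quotient h ?D s x)"
    unfolding time_quotient_def [of h ?D] using h by (simp add: norm_divide)
  finally show ?case using h by (simp add: field_simps)
qed

lemma norm_prim_power_le:
  fixes f :: "real \<Rightarrow> complex"
  assumes "0 \<le> x" "continuous_on UNIV f" "\<And>y. y \<in> {0..x} \<Longrightarrow> norm (f y) \<le> C * (y ^ p / fact p)"
  shows "norm (prim f x) \<le> C * (x ^ Suc p / fact (Suc p))"
proof -
  have "norm (prim f x) \<le> C * (x ^ Suc p / fact (Suc p)) - C * (0 ^ Suc p / fact (Suc p))"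
  proof (rule norm_prim_le [OF assms(1,2) _ assms(3)])
    show "((\<lambda>y. C * (y ^ Suc p / fact (Suc p))) has_real_derivative C * (y ^ p / fact p)) (at y within {0..x})" for y
    proof -
      have "((\<lambda>y. C / fact (Suc p) * y ^ Suc p) has_real_derivative
          C / fact (Suc p) * (real (Suc p) * y ^ p)) (at y within {0..x})"
        using DERIV_pow [of "Suc p" y "{0..x}"] by (intro DERIV_cmult) simp
      moreover have "C / fact (Suc p) * (real (Suc p) * y ^ p) = C * (y ^ p / fact p)"
        unfolding fact_Suc of_nat_mult by (simp del: of_nat_Suc)
      ultimately show ?thesis by (simp del: fact_Suc)
    qed
  qed auto
  then show ?thesis by simp
qed

lemma fact_mult_power_le: "fact n * of_nat n ^ j \<le> (fact (n + j) :: real)"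
proof (induction j)
  case (Suc j)
  have "fact n * real n ^ Suc j = real n * (fact n * real n ^ j)" by simp
  also have "\<dots> \<le> (1 + real (n + j)) * fact (n + j)"
    using Suc by (intro mult_mono) auto
  finally show ?case by simp
qed simp

locale lateral_problem =
  fixes X T :: real and \<sigma> :: complex and Q :: "real \<Rightarrow> complex" and q :: real
  assumes X_nonneg: "0 \<le> X" and Q_cont: "continuous_on UNIV Q" and Q_le: "\<And>x. norm (Q x) \<le> q"
begin

text \<open>
  The equation \<open>\<sigma> Z\<^sub>t = Z\<^sub>x\<^sub>x - Q Z\<close> with zero Cauchy data at \<open>x = 0\<close>, integrated twice in \<open>x\<close>, where \<open>W\<close>
  takes the place of the time derivative of \<open>Y\<close>. In this form it is stable under averages and
  difference quotients in time.
\<close>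

definition related :: "real \<Rightarrow> (real \<Rightarrow> real \<Rightarrow> complex) \<Rightarrow> (real \<Rightarrow> real \<Rightarrow> complex) \<Rightarrow> bool" where
  "related S Y W \<longleftrightarrow> joint_cont Y \<and> joint_cont W \<and>
     (\<forall>t\<in>{0..S}. \<forall>x\<in>{0..X}. Y t x = prim (prim (\<lambda>y. \<sigma> * W t y + Q y * Y t y)) x)"

lemma related_time_quotient:
  assumes rel: "related S Y W" and h: "0 < h"
  shows "related (S - h) (time_quotient h Y) (time_quotient h W)"
  unfolding related_def
proof (intro conjI ballI)
  have Y: "joint_cont Y" and W: "joint_cont W" using rel by (auto simp: related_def)
  then show "joint_cont (time_quotient h Y)" "joint_cont (time_quotient h W)" by (auto intro: joint_cont_time_quotient)
  fix t x assume t: "t \<in> {0..S - h}" and x: "x \<in> {0..X}"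
  let ?f = "\<lambda>t y. \<sigma> * W t y + Q y * Y t y"
  have c: "continuous_on UNIV (?f t)" for t
    by (intro continuous_intros Q_cont joint_contD [OF Y] joint_contD [OF W])
  have c': "continuous_on UNIV (prim (?f t))" for t
    by (rule continuous_on_if_vderiv [OF has_vector_derivative_prim [OF c]])
  have "time_quotient h Y t x = inverse (of_real h) * (prim (prim (?f (t + h))) x - prim (prim (?f t)) x)"
    using rel t x h by (auto simp: related_def time_quotient_def divide_inverse)
  also have "\<dots> = prim (prim (\<lambda>y. inverse (of_real h) * (?f (t + h) y - ?f t y))) x"
    using prim_diff [OF c c] prim_diff [OF c' c']
    by (simp add: prim_mult_left [abs_def])
  also have "(\<lambda>y. inverse (of_real h) * (?f (t + h) y - ?f t y))
      = (\<lambda>y. \<sigma> * time_quotient h W t y + Q y * time_quotient h Y t y)"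
    by (simp add: time_quotient_def divide_inverse algebra_simps)
  finally show "time_quotient h Y t x = prim (prim (\<lambda>y. \<sigma> * time_quotient h W t y + Q y * time_quotient h Y t y)) x" .
qed

lemma related_time_average:
  assumes rel: "related S Y W" and h: "0 < h"
  shows "related (S - h) (time_average h Y) (time_average h W)"
  unfolding related_def
proof (intro conjI ballI)
  have Y: "joint_cont Y" and W: "joint_cont W" using rel by (auto simp: related_def)
  then show "joint_cont (time_average h Y)" "joint_cont (time_average h W)" by (auto intro: joint_cont_time_average)
  fix t x assume t: "t \<in> {0..S - h}" and x: "x \<in> {0..X}"
  let ?f = "\<lambda>\<theta> y. \<sigma> * W (t + h * \<theta>) y + Q y * Y (t + h * \<theta>) y"
  have c: "continuous_on UNIV (\<lambda>q. ?f (fst q) (snd q))"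
    by (intro continuous_intros continuous_on_comp [OF Q_cont] joint_contD [OF Y] joint_contD [OF W])
  have c': "continuous_on UNIV (\<lambda>q. prim (?f (fst q)) (snd q))"
    by (intro continuous_intros continuous_on_comp [OF Q_cont] joint_contD [OF Y] joint_contD [OF W])
  have "time_average h Y t x = prim (\<lambda>\<theta>. prim (prim (?f \<theta>)) x) 1"
    unfolding time_average_def
  proof (rule prim_cong)
    fix \<theta> :: real assume \<theta>: "\<theta> \<in> {0..1}"
    then have "h * \<theta> \<le> h" "0 \<le> h * \<theta>" using h by (auto intro: mult_left_le)
    then have "t + h * \<theta> \<in> {0..S}" using t unfolding atLeastAtMost_iff by linarith
    then show "Y (t + h * \<theta>) x = prim (prim (?f \<theta>)) x"
      using rel x by (auto simp: related_def)
  qed simp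
  also have "\<dots> = prim (prim (\<lambda>y. prim (\<lambda>\<theta>. ?f \<theta> y) 1)) x"
    using prim_swap [OF c] prim_swap [OF c'] by simp
  also have "(\<lambda>y. prim (\<lambda>\<theta>. ?f \<theta> y) 1) = (\<lambda>y. \<sigma> * time_average h W t y + Q y * time_average h Y t y)"
    unfolding time_average_def
    by (subst prim_add) (auto simp: prim_mult_left intro!: continuous_intros joint_contD [OF Y] joint_contD [OF W])
  finally show "time_average h Y t x = prim (prim (\<lambda>y. \<sigma> * time_average h W t y + Q y * time_average h Y t y)) x" .
qed

text \<open>
  Averages commute with difference quotients, so both families of operators can be applied to the same
  basic relation.
\<close>

lemma related_pow:
  assumes rel: "related (T - h) (time_average h Z) (time_quotient h Z)" and h: "0 < h" and Z: "joint_cont Z"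
  shows "related (T - real (Suc (n + j)) * h) ((time_average h ^^ Suc n) ((time_quotient h ^^ j) Z))
           ((time_average h ^^ n) ((time_quotient h ^^ Suc j) Z))"
proof -
  have "related (T - real (Suc j) * h) ((time_quotient h ^^ j) (time_average h Z)) ((time_quotient h ^^ j) (time_quotient h Z))"
  proof (induction j)
    case (Suc j)
    from related_time_quotient [OF this h] show ?case by (simp add: algebra_simps)
  qed (use rel in simp)
  then have 0: "related (T - real (Suc j) * h) (time_average h ((time_quotient h ^^ j) Z)) ((time_quotient h ^^ Suc j) Z)"
    by (simp add: time_quotient_pow_time_average_commute [OF Z] funpow_swap1)
  have "related (T - real (Suc (n + j)) * h) ((time_average h ^^ n) (time_average h ((time_quotient h ^^ j) Z)))
      ((time_average h ^^ n) ((time_quotient h ^^ Suc j) Z))"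
  proof (induction n)
    case (Suc n)
    from related_time_average [OF this h] show ?case by (simp add: algebra_simps)
  qed (use 0 in simp)
  then show ?thesis by (simp add: funpow_swap1)
qed

text \<open>
  Each of the \<open>m\<close> rounds trades one average for one difference quotient, which costs \<open>2/h\<close>, and two
  integrations in \<open>x\<close>. Since \<open>j\<close> difference quotients of a function bounded by \<open>M\<close> are bounded by
  \<open>M (2/h)\<^sup>j\<close>, the total cost is geometric and the gain is \<open>1/(2m)!\<close>.
\<close>

lemma norm_time_average_time_quotient_le:
  assumes rel: "related (T - h) (time_average h Z) (time_quotient h Z)" and h: "0 < h" and Z: "joint_cont Z"
    and M: "\<And>t x. t \<in> {0..T} \<Longrightarrow> x \<in> {0..X} \<Longrightarrow> norm (Z t x) \<le> M"
    and "m \<le> n" "t \<in> {0..T - real (n + j) * h}" "x \<in> {0..X}"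
  shows "norm ((time_average h ^^ n) ((time_quotient h ^^ j) Z) t x)
    \<le> M * (2 / h) ^ j * (norm \<sigma> * (2 / h) + q) ^ m * (x ^ (2 * m) / fact (2 * m))"
  using assms(5-)
proof (induction m arbitrary: n j t x)
  case 0
  have "norm ((time_average h ^^ n) ((time_quotient h ^^ j) Z) t x - 0) \<le> M * (2 / h) ^ j"
  proof (rule norm_time_average_pow_le [OF joint_cont_time_quotient_pow [OF Z]])
    show "norm ((time_quotient h ^^ j) Z s x - 0) \<le> M * (2 / h) ^ j"
      if "s \<in> {t..t + n * h}" for s
      unfolding diff_zero using that 0
      by (intro norm_time_quotient_pow_le [OF h, where T = T] M) (auto simp: algebra_simps)
  qed (use h in auto)
  then show ?case by simp
next
  case (Suc m)
  from Suc.prems(1) obtain n' where n: "n = Suc n'" "m \<le> n'" by (cases n) auto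
  define Y where "Y = (time_average h ^^ n) ((time_quotient h ^^ j) Z)"
  define W where "W = (time_average h ^^ n') ((time_quotient h ^^ Suc j) Z)"
  define C where "C = norm \<sigma> * (2 / h) + q"
  have rel': "related (T - real (n + j) * h) Y W"
    using related_pow [OF rel h Z, of n' j] by (simp add: Y_def W_def n)
  then have Y: "joint_cont Y" and W: "joint_cont W" by (auto simp: related_def)
  have q: "0 \<le> q" using Q_le [of 0] norm_ge_zero order_trans by blast
  let ?f = "\<lambda>y. \<sigma> * W t y + Q y * Y t y"
  have c: "continuous_on UNIV ?f"
    by (intro continuous_intros Q_cont joint_contD [OF Y] joint_contD [OF W])
  have f: "norm (?f y) \<le> M * (2 / h) ^ j * C ^ Suc m * (y ^ (2 * m) / fact (2 * m))"
    if y: "y \<in> {0..X}" for y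
  proof -
    define B where "B = M * (2 / h) ^ j * C ^ m * (y ^ (2 * m) / fact (2 * m))"
    have WB: "norm (W t y) \<le> (2 / h) * B"
      using Suc.IH [of n' t "Suc j" y] n Suc.prems y by (simp add: W_def B_def C_def mult_ac)
    have YB: "norm (Y t y) \<le> B"
      using Suc.IH [of n t j y] n Suc.prems y by (simp add: Y_def B_def C_def)
    have "norm (?f y) \<le> norm \<sigma> * ((2 / h) * B) + q * B"
      by (intro norm_triangle_le add_mono; subst norm_mult; intro mult_mono WB YB Q_le q) auto
    also have "\<dots> = C * B" by (simp add: C_def algebra_simps)
    finally show ?thesis by (simp add: B_def mult_ac)
  qed
  have "norm (prim (prim ?f) x) \<le> M * (2 / h) ^ j * C ^ Suc m * (x ^ Suc (Suc (2 * m)) / fact (Suc (Suc (2 * m))))"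
  proof (rule norm_prim_power_le)
    show "continuous_on UNIV (prim ?f)"
      by (rule continuous_on_if_vderiv [OF has_vector_derivative_prim [OF c]])
    show "norm (prim ?f y) \<le> M * (2 / h) ^ j * C ^ Suc m * (y ^ Suc (2 * m) / fact (Suc (2 * m)))"
      if "y \<in> {0..x}" for y
      using that Suc.prems by (intro norm_prim_power_le c f) auto
  qed (use Suc.prems in auto)
  moreover have "Y t x = prim (prim ?f) x"
    using rel' Suc.prems by (auto simp: related_def)
  ultimately show ?case by (simp add: Y_def C_def)
qed

text \<open>
  Choose the step \<open>h = \<delta>/N\<close>, so that \<open>N\<close>-fold averaging looks ahead by exactly \<open>\<delta>\<close> for every \<open>N\<close>. The
  bound with \<open>m = n = N\<close> then tends to \<open>0\<close> by \<open>N\<^sup>N N! \<le> (2N)!\<close>, and continuity in time controls the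
  effect of averaging.
\<close>

lemma lateral_uniqueness:
  assumes Z: "joint_cont Z" and G: "joint_cont G"
    and eq: "\<And>t x. t \<in> {0..T} \<Longrightarrow> x \<in> {0..X} \<Longrightarrow>
      Z t x = prim (prim (\<lambda>y. \<sigma> * G t y + Q y * Z t y)) x"
    and deriv: "\<And>t h x. 0 < h \<Longrightarrow> t \<in> {0..T} \<Longrightarrow> t + h \<in> {0..T} \<Longrightarrow> x \<in> {0..X} \<Longrightarrow>
      time_average h G t x = time_quotient h Z t x"
    and t: "t \<in> {0..T}" and x: "x \<in> {0..X}" and T: "0 < T"
  shows "Z t x = 0"
proof -
  have rel: "related (T - h) (time_average h Z) (time_quotient h Z)" if h: "0 < h" for h
  proof -
    have "related T Z G" using Z G eq by (simp add: related_def)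
    from related_time_average [OF this h] have "related (T - h) (time_average h Z) (time_average h G)" .
    moreover have "prim (prim (\<lambda>y. \<sigma> * time_average h G t y + Q y * time_average h Z t y)) x
        = prim (prim (\<lambda>y. \<sigma> * time_quotient h Z t y + Q y * time_average h Z t y)) x"
      if "t \<in> {0..T - h}" "x \<in> {0..X}" for t x
      using that h deriv by (intro prim_cong) auto
    ultimately show ?thesis using Z by (simp add: related_def joint_cont_time_quotient)
  qed
  have "compact ((\<lambda>q. Z (fst q) (snd q)) ` ({0..T} \<times> {0..X}))"
    by (intro compact_continuous_image compact_Times joint_contD [OF Z] continuous_intros) auto
  then obtain M where M0: "0 < M" and M: "\<And>t x. t \<in> {0..T} \<Longrightarrow> x \<in> {0..X} \<Longrightarrow> norm (Z t x) \<le> M"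
    by (force dest!: compact_imp_bounded simp: bounded_pos)
  have q: "0 \<le> q" using Q_le [of 0] norm_ge_zero order_trans by blast
  have zero: "Z t x = 0" if t: "t \<in> {0..<T}" for t
  proof -
    have "norm (Z t x) \<le> e" if e: "0 < e" for e
    proof -
      have "continuous_on UNIV (\<lambda>s. Z s x)" by (intro joint_contD [OF Z] continuous_intros)
      then obtain d where d: "0 < d" "\<And>s. dist s t < d \<Longrightarrow> dist (Z s x) (Z t x) < e"
        using e by (metis UNIV_I continuous_on_iff)
      define \<delta> where "\<delta> = min (d / 2) (T - t)"
      have \<delta>: "0 < \<delta>" "t + \<delta> \<le> T" "\<delta> < d" using d t by (auto simp: \<delta>_def)
      have near: "norm (Z s x - Z t x) \<le> e" if "s \<in> {t..t + \<delta>}" for s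
        using d(2) [of s] that \<delta> by (auto simp: dist_norm)
      define K where "K = (norm \<sigma> * (2 / \<delta>) + q) * X ^ 2"
      have bound: "norm (Z t x) \<le> M * (K ^ N / fact N) + e" if N: "0 < N" for N
      proof -
        \<comment> \<open>\<open>N\<close> averages of step \<open>h\<close> together use the values of \<open>Z\<close> on \<open>[t, t + \<delta>]\<close>\<close>
        define h where "h = \<delta> / real N"
        have h: "0 < h" "real N * h = \<delta>" using \<delta> N by (auto simp: h_def)
        have "norm ((time_average h ^^ N) Z t x - Z t x) \<le> e"
          by (rule norm_time_average_pow_le [OF Z _ near]) (use h \<delta> in auto)
        moreover have "norm ((time_average h ^^ N) Z t x) \<le> M * (norm \<sigma> * (2 / h) + q) ^ N * (x ^ (2 * N) / fact (2 * N))"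
          using norm_time_average_time_quotient_le [OF rel [OF h(1)] h(1) Z M order_refl, of t N 0 x] h \<delta> t x by simp
        moreover have "M * (norm \<sigma> * (2 / h) + q) ^ N * (x ^ (2 * N) / fact (2 * N)) \<le> M * (K ^ N / fact N)"
        proof -
          have 1: "norm \<sigma> * (2 / h) + q \<le> real N * (norm \<sigma> * (2 / \<delta>) + q)"
            using N q \<delta> mult_right_mono [of 1 "real N" q] by (simp add: h_def field_simps)
          have "(norm \<sigma> * (2 / h) + q) ^ N * x ^ (2 * N)
              \<le> (real N * (norm \<sigma> * (2 / \<delta>) + q)) ^ N * X ^ (2 * N)"
            using 1 q h x \<delta> by (intro mult_mono power_mono) auto
          also have "\<dots> = K ^ N * real N ^ N"
            by (simp add: K_def power_mult_distrib power_mult)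
          finally have 2: "(norm \<sigma> * (2 / h) + q) ^ N * x ^ (2 * N) \<le> K ^ N * real N ^ N" .
          have K: "0 \<le> K" using q \<delta> by (simp add: K_def)
          have "(norm \<sigma> * (2 / h) + q) ^ N * x ^ (2 * N) * fact N \<le> K ^ N * (fact N * real N ^ N)"
            using mult_right_mono [OF 2, of "fact N"] by (simp add: mult_ac)
          also have "\<dots> \<le> K ^ N * fact (2 * N)"
            using fact_mult_power_le [of N N] K by (intro mult_left_mono) (auto simp: mult_2)
          finally have "(norm \<sigma> * (2 / h) + q) ^ N * (x ^ (2 * N) / fact (2 * N)) \<le> K ^ N / fact N"
            by (simp add: field_simps)
          from mult_left_mono [OF this, of M] M0 show ?thesis by (simp add: mult_ac)
        qed
        ultimately show ?thesis
          using norm_triangle_ineq4 [of "(time_average h ^^ N) Z t x" "(time_average h ^^ N) Z t x - Z t x"] by simp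
      qed
      have "(\<lambda>N. M * (K ^ N / fact N) + e) \<longlonglongrightarrow> M * 0 + e"
        using summable_LIMSEQ_zero [OF summable_exp [of K]]
        by (intro tendsto_intros) (simp add: divide_inverse mult.commute)
      then have "norm (Z t x) \<le> M * 0 + e"
        by (rule LIMSEQ_le_const) (use bound in \<open>auto intro!: exI [of _ 1]\<close>)
      then show ?thesis by simp
    qed
    then have "norm (Z t x) \<le> 0" by (metis field_le_epsilon add_0)
    then show ?thesis by simp
  qed
  have "Z t x = 0" if "t \<in> closure {0..<T}" for t
    by (rule continuous_constant_on_closure [of "{0..<T}" "\<lambda>t. Z t x", OF _ zero that])
       (intro joint_contD [OF Z] continuous_intros)
  then show ?thesis using t T by (simp add: closure_atLeastLessThan)
qed

end

section \<open>The integral equation at the observation time\<close>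

text \<open>
  The derivatives are arguments, so that closed formulas can be supplied for them when a solution is
  obtained by a change of variables.
\<close>

definition solves ::
  "complex \<Rightarrow> real \<Rightarrow> real \<Rightarrow> (real \<Rightarrow> complex) \<Rightarrow> (real \<Rightarrow> real \<Rightarrow> complex) \<Rightarrow>
    (real \<Rightarrow> real \<Rightarrow> complex) \<Rightarrow> (real \<Rightarrow> real \<Rightarrow> complex) \<Rightarrow> bool" where
  "solves \<sigma> T L P U Ux Ut \<longleftrightarrow>
     continuous_on ({0..T} \<times> {0..L}) (\<lambda>q. U (fst q) (snd q)) \<and>
     continuous_on ({0..T} \<times> {0..L}) (\<lambda>q. Ux (fst q) (snd q)) \<and>
     continuous_on ({0..T} \<times> {0..L}) (\<lambda>q. Ut (fst q) (snd q)) \<and>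
     (\<forall>t\<in>{0..T}. \<forall>x\<in>{0..L}.
        (U t has_vector_derivative Ux t x) (at x within {0..L}) \<and>
        (Ux t has_vector_derivative \<sigma> * Ut t x + P x * U t x) (at x within {0..L}) \<and>
        ((\<lambda>s. U s x) has_vector_derivative Ut t x) (at t within {0..T}))"

lemma continuous_on_clip2:
  assumes "continuous_on ({0..T} \<times> {0..L}) (\<lambda>q. F (fst q) (snd q))" "0 \<le> T" "0 \<le> L"
    "continuous_on A f" "continuous_on A g"
  shows "continuous_on A (\<lambda>x. F (clip T (f x)) (clip L (g x)))"
proof -
  have "continuous_on A (\<lambda>x. (clip T (f x), clip L (g x)))"
    by (intro continuous_intros assms)
  moreover have "(\<lambda>x. (clip T (f x), clip L (g x))) ` A \<subseteq> {0..T} \<times> {0..L}"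
    using clip_bounds assms(2,3) by auto
  ultimately show ?thesis
    using continuous_on_compose2 [OF assms(1), of A "\<lambda>x. (clip T (f x), clip L (g x))"] by simp
qed

text \<open>
  Outside the rectangle the second derivative is continued by boundary values and integrated twice, so
  that the extension stays twice differentiable in \<open>x\<close>.
\<close>

lemma solves_extend:
  assumes sol: "solves \<sigma> T L P U Ux Ut" and TL: "0 \<le> T" "0 \<le> L" and P: "continuous_on UNIV P"
  obtains Ue U\<^sub>1 U\<^sub>2 Ud where "joint_cont Ue" "joint_cont U\<^sub>2" "joint_cont Ud"
    and "\<And>t x. (Ue t has_vector_derivative U\<^sub>1 t x) (at x)"
    and "\<And>t x. (U\<^sub>1 t has_vector_derivative U\<^sub>2 t x) (at x)"
    and "\<And>t x. t \<in> {0..T} \<Longrightarrow> x \<in> {0..L} \<Longrightarrow>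
          Ue t x = U t x \<and> U\<^sub>1 t x = Ux t x \<and> Ud t x = Ut t x \<and> U\<^sub>2 t x = \<sigma> * Ut t x + P x * U t x"
proof -
  define Ud where "Ud t x = Ut (clip T t) (clip L x)" for t x
  define U\<^sub>2 where "U\<^sub>2 t x = \<sigma> * Ut (clip T t) (clip L x) + P x * U (clip T t) (clip L x)" for t x
  define U\<^sub>1 where "U\<^sub>1 t x = Ux (clip T t) (clip L 0) + prim (U\<^sub>2 t) x" for t x
  define Ue where "Ue t x = U (clip T t) (clip L 0) + prim (U\<^sub>1 t) x" for t x
  have U: "continuous_on ({0..T} \<times> {0..L}) (\<lambda>q. U (fst q) (snd q))"
    and Ux: "continuous_on ({0..T} \<times> {0..L}) (\<lambda>q. Ux (fst q) (snd q))"
    and Ut: "continuous_on ({0..T} \<times> {0..L}) (\<lambda>q. Ut (fst q) (snd q))"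
    using sol by (auto simp: solves_def)
  note cl = continuous_on_clip2 [OF U TL] continuous_on_clip2 [OF Ux TL] continuous_on_clip2 [OF Ut TL]
  have c2: "joint_cont U\<^sub>2"
    unfolding joint_cont_def U\<^sub>2_def by (intro continuous_intros cl continuous_on_comp [OF P])
  have c1: "joint_cont U\<^sub>1"
    unfolding joint_cont_def U\<^sub>1_def by (intro continuous_on_add continuous_on_prim cl joint_contD [OF c2] continuous_intros)
  have c0: "joint_cont Ue"
    unfolding joint_cont_def Ue_def by (intro continuous_on_add continuous_on_prim cl joint_contD [OF c1] continuous_intros)
  have cd: "joint_cont Ud"
    unfolding joint_cont_def Ud_def by (intro cl continuous_intros)
  have d1: "(U\<^sub>1 t has_vector_derivative U\<^sub>2 t x) (at x)" for t x
  proof -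
    have "continuous_on UNIV (U\<^sub>2 t)" by (intro joint_contD [OF c2] continuous_intros)
    from has_vector_derivative_add [OF has_vector_derivative_const has_vector_derivative_prim [OF this]]
    show ?thesis unfolding U\<^sub>1_def by simp
  qed
  have d0: "(Ue t has_vector_derivative U\<^sub>1 t x) (at x)" for t x
  proof -
    have "continuous_on UNIV (U\<^sub>1 t)" by (intro joint_contD [OF c1] continuous_intros)
    from has_vector_derivative_add [OF has_vector_derivative_const has_vector_derivative_prim [OF this]]
    show ?thesis unfolding Ue_def by simp
  qed
  have e1: "U\<^sub>1 t x = Ux t x" if t: "t \<in> {0..T}" and x: "x \<in> {0..L}" for t x
  proof -
    have "prim (U\<^sub>2 t) x = Ux t x - Ux t 0"
    proof (rule prim_eq_diff_nonneg)
      show "(Ux t has_vector_derivative U\<^sub>2 t y) (at y within {0..x})" if "y \<in> {0..x}" for y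
        by (rule has_vector_derivative_within_subset [of _ _ _ "{0..L}"])
           (use sol t x that in \<open>auto simp: solves_def U\<^sub>2_def\<close>)
    qed (use x in auto)
    then show ?thesis using t TL by (simp add: U\<^sub>1_def)
  qed
  have e0: "Ue t x = U t x" if t: "t \<in> {0..T}" and x: "x \<in> {0..L}" for t x
  proof -
    have "prim (U\<^sub>1 t) x = U t x - U t 0"
    proof (rule prim_eq_diff_nonneg)
      show "(U t has_vector_derivative U\<^sub>1 t y) (at y within {0..x})" if "y \<in> {0..x}" for y
        by (rule has_vector_derivative_within_subset [of _ _ _ "{0..L}"])
           (use sol t x that e1 in \<open>auto simp: solves_def\<close>)
    qed (use x in auto)
    then show ?thesis using t TL by (simp add: Ue_def)
  qed
  show thesis
    by (rule that [OF c0 c2 cd d0 d1]) (simp add: e0 e1 Ud_def U\<^sub>2_def)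
qed

lemma time_average_of_derivative:
  assumes sol: "solves \<sigma> T L P U Ux Ut" and h: "0 < h" and t: "t \<in> {0..T}" "t + h \<in> {0..T}"
    and x: "x \<in> {0..L}"
    and F: "\<And>s. s \<in> {0..T} \<Longrightarrow> F s x = U s x" and G: "\<And>s. s \<in> {0..T} \<Longrightarrow> G s x = Ut s x"
  shows "time_average h G t x = time_quotient h F t x"
proof -
  have s: "t + h * \<theta> \<in> {0..T}" if "\<theta> \<in> {0..1}" for \<theta>
  proof -
    have "h * \<theta> \<le> h" "0 \<le> h * \<theta>" using h that by (auto intro: mult_left_le)
    then show ?thesis using t unfolding atLeastAtMost_iff by linarith
  qed
  have "prim (\<lambda>\<theta>. Ut (t + h * \<theta>) x) 1 = inverse (of_real h) * U (t + h * 1) x - inverse (of_real h) * U (t + h * 0) x"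
  proof (rule prim_eq_diff_nonneg)
    fix \<theta> :: real assume \<theta>: "\<theta> \<in> {0..1}"
    have "(((\<lambda>s. U s x) \<circ> (\<lambda>\<theta>. t + h * \<theta>)) has_vector_derivative h *\<^sub>R Ut (t + h * \<theta>) x) (at \<theta> within {0..1})"
    proof (rule vector_diff_chain_within)
      show "((\<lambda>\<theta>. t + h * \<theta>) has_vector_derivative h) (at \<theta> within {0..1})"
        by (auto intro!: derivative_eq_intros)
      show "((\<lambda>s. U s x) has_vector_derivative Ut (t + h * \<theta>) x)
          (at (t + h * \<theta>) within (\<lambda>\<theta>. t + h * \<theta>) ` {0..1})"
        by (rule has_vector_derivative_within_subset [of _ _ _ "{0..T}"])
           (use sol s \<theta> x in \<open>auto simp: solves_def\<close>)
    qed
    from has_vector_derivative_mult_right [OF this, of "inverse (of_real h)"]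
    show "((\<lambda>\<theta>. inverse (of_real h) * U (t + h * \<theta>) x) has_vector_derivative Ut (t + h * \<theta>) x) (at \<theta> within {0..1})"
      using h by (simp add: o_def scaleR_conv_of_real mult.assoc [symmetric])
  qed simp
  moreover have "time_average h G t x = prim (\<lambda>\<theta>. Ut (t + h * \<theta>) x) 1"
    unfolding time_average_def by (rule prim_cong) (use G s in auto)
  ultimately show ?thesis
    using t F by (simp add: time_quotient_def divide_inverse algebra_simps)
qed

lemma prim_prim_cong:
  assumes "0 \<le> x" "\<And>y. y \<in> {0..x} \<Longrightarrow> f y = g y"
  shows "prim (prim f) x = prim (prim g) x"
  using assms by (intro prim_cong) auto

lemma prim_eq_0_imp_eq_0:
  fixes f :: "real \<Rightarrow> complex"
  assumes f: "continuous_on UNIV f" and 0: "\<And>x. x \<in> {0<..<X} \<Longrightarrow> prim f x = 0" and x: "x \<in> {0<..<X}"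
  shows "f x = 0"
proof -
  have "((\<lambda>x. 0) has_vector_derivative f x) (at x)"
    by (rule has_vector_derivative_transform_within_open
        [OF has_vector_derivative_prim [OF f] open_greaterThanLessThan x]) (use 0 in auto)
  then show ?thesis
    using has_vector_derivative_const vector_derivative_unique_at by blast
qed

context kernel
begin

lemma joint_cont_transform:
  assumes "joint_cont F"
  shows "joint_cont (\<lambda>t. transform (F t))"
  unfolding joint_cont_def transform_def
  by (intro continuous_on_mult continuous_on_prim continuous_on_comp2 [OF k_cont] joint_contD [OF assms]
      continuous_intros) auto

lemma transform_time_average:
  assumes F: "joint_cont F"
  shows "time_average h (\<lambda>t. transform (F t)) t x = transform (time_average h F t) x"
proof -
  have "continuous_on UNIV (\<lambda>q. k (x - snd q) (snd q) * F (t + h * fst q) (x - 2 * snd q))"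
    by (intro continuous_on_mult continuous_on_comp2 [OF k_cont] joint_contD [OF F] continuous_intros)
  from prim_swap [OF this, of "x / 2" 1] show ?thesis
    unfolding time_average_def transform_def by (simp add: prim_mult_left)
qed

lemma transform_time_quotient:
  assumes F: "joint_cont F"
  shows "time_quotient h (\<lambda>t. transform (F t)) t x = transform (time_quotient h F t) x"
proof -
  have c: "continuous_on UNIV (\<lambda>\<eta>. k (x - \<eta>) \<eta> * F s (x - 2 * \<eta>))" for s
    by (intro continuous_on_mult continuous_on_comp2 [OF k_cont] joint_contD [OF F] continuous_intros)
  have "(\<lambda>\<eta>. k (x - \<eta>) \<eta> * time_quotient h F t (x - 2 * \<eta>)) = (\<lambda>\<eta>. inverse (of_real h) *
      (k (x - \<eta>) \<eta> * F (t + h) (x - 2 * \<eta>) - k (x - \<eta>) \<eta> * F t (x - 2 * \<eta>)))"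
    unfolding time_quotient_def divide_inverse by (intro ext) algebra
  then have "transform (time_quotient h F t) x = 2 * (inverse (of_real h) *
      (prim (\<lambda>\<eta>. k (x - \<eta>) \<eta> * F (t + h) (x - 2 * \<eta>)) (x / 2)
       - prim (\<lambda>\<eta>. k (x - \<eta>) \<eta> * F t (x - 2 * \<eta>)) (x / 2)))"
    unfolding transform_def by (simp only: prim_mult_left prim_diff [OF c c])
  then show ?thesis
    unfolding time_quotient_def transform_def divide_inverse by algebra
qed

lemma transform_cong:
  assumes "0 \<le> x" "\<And>y. y \<in> {0..x} \<Longrightarrow> f y = g y"
  shows "transform f x = transform g x"
  unfolding transform_def using assms by (auto intro!: prim_cong)

text \<open>
  The difference of \<open>V - U\<close> and the transform of \<open>U\<close> satisfies the equation of \<open>V\<close> with zero Cauchy data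
  at \<open>x = 0\<close>, hence vanishes on \<open>[0,X]\<close>. At the time \<open>t\<^sub>0\<close> the transform of \<open>U\<close> is therefore zero, and so is
  its second derivative, which is the equation claimed.
\<close>

lemma initial_integral_equation:
  assumes T: "0 < T" and X: "0 \<le> X" "X \<le> L" and t\<^sub>0: "t\<^sub>0 \<in> {0..T}"
    and Q_le: "\<And>x. norm (Q x) \<le> q"
    and U: "solves \<sigma> T L P U Ux Ut" and V: "solves \<sigma> T L Q V Vx Vt"
    and lateral: "\<And>t. t \<in> {0..T} \<Longrightarrow> U t 0 = V t 0 \<and> Ux t 0 = Vx t 0"
    and initial: "\<And>x. x \<in> {0..L} \<Longrightarrow> U t\<^sub>0 x = V t\<^sub>0 x"
    and boundary: "\<And>t x. t \<in> {0..T} \<Longrightarrow> x \<in> {0..X} \<Longrightarrow>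
      k (x / 2) (x / 2) * Ux t 0 + \<gamma> / 2 * \<kappa> (x / 2) (x / 2) * U t 0 = 0"
  obtains e where "joint_cont e"
    and "\<And>x. x \<in> {0<..<X} \<Longrightarrow>
      (Q x - P x) * U t\<^sub>0 x = - 2 * prim (\<lambda>\<eta>. k (x - \<eta>) \<eta> * e x \<eta>) (x / 2)"
proof -
  have TL: "0 \<le> T" "0 \<le> L" using T L_nonneg by auto
  obtain Ue U\<^sub>1 U\<^sub>2 Ud where cU: "joint_cont Ue" "joint_cont U\<^sub>2" "joint_cont Ud"
    and dU: "\<And>t x. (Ue t has_vector_derivative U\<^sub>1 t x) (at x)"
      "\<And>t x. (U\<^sub>1 t has_vector_derivative U\<^sub>2 t x) (at x)"
    and eU: "\<And>t x. t \<in> {0..T} \<Longrightarrow> x \<in> {0..L} \<Longrightarrow>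
          Ue t x = U t x \<and> U\<^sub>1 t x = Ux t x \<and> Ud t x = Ut t x \<and> U\<^sub>2 t x = \<sigma> * Ut t x + P x * U t x"
    by (rule solves_extend [OF U TL P_cont]) (rule that)
  obtain Ve V\<^sub>1 V\<^sub>2 Vd where cV: "joint_cont Ve" "joint_cont V\<^sub>2" "joint_cont Vd"
    and dV: "\<And>t x. (Ve t has_vector_derivative V\<^sub>1 t x) (at x)"
      "\<And>t x. (V\<^sub>1 t has_vector_derivative V\<^sub>2 t x) (at x)"
    and eV: "\<And>t x. t \<in> {0..T} \<Longrightarrow> x \<in> {0..L} \<Longrightarrow>
          Ve t x = V t x \<and> V\<^sub>1 t x = Vx t x \<and> Vd t x = Vt t x \<and> V\<^sub>2 t x = \<sigma> * Vt t x + Q x * V t x"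
    by (rule solves_extend [OF V TL Q_cont]) (rule that)
  have sl: "continuous_on UNIV (F t)" if "joint_cont F" for F t
    by (intro joint_contD [OF that] continuous_intros)
  define W where "W = (\<lambda>t. transform (Ue t))"
  define Wd where "Wd = (\<lambda>t. transform (Ud t))"
  have cW: "joint_cont W" "joint_cont Wd"
    unfolding W_def Wd_def by (intro joint_cont_transform cU)+
  define e where "e x \<eta> = Q x * Ue t\<^sub>0 (x - 2 * \<eta>) + \<sigma> * Ud t\<^sub>0 (x - 2 * \<eta>)" for x \<eta>
  define N where "N t x = (Q x - P x) * Ue t x
     + (k (x / 2) (x / 2) * U\<^sub>1 t 0 + \<gamma> / 2 * \<kappa> (x / 2) (x / 2) * Ue t 0)
     + 2 * prim (\<lambda>\<eta>. \<rho> (x - \<eta>) \<eta> * Ue t (x - 2 * \<eta>) + k (x - \<eta>) \<eta> * U\<^sub>2 t (x - 2 * \<eta>)) (x / 2)" for t x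
  have N_cont: "continuous_on UNIV (N t)" and W_eq: "W t x = prim (prim (N t)) x" for t x
    using transform_eq_prim_prim [OF dU(1) [of t] dU(2) [of t] sl [OF cU(2)]]
    unfolding W_def N_def by auto
  \<comment> \<open>the term with \<open>P\<close> in \<open>\<rho>\<close> cancels against the potential term in the equation of \<open>U\<close>\<close>
  have N_eq: "N t x = (Q x - P x) * U t x
     + 2 * prim (\<lambda>\<eta>. k (x - \<eta>) \<eta> * (Q x * Ue t (x - 2 * \<eta>) + \<sigma> * Ud t (x - 2 * \<eta>))) (x / 2)"
    if t: "t \<in> {0..T}" and x: "x \<in> {0..X}" for t x
  proof -
    have "k (x / 2) (x / 2) * U\<^sub>1 t 0 + \<gamma> / 2 * \<kappa> (x / 2) (x / 2) * Ue t 0 = 0"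
      using boundary [OF t x] eU [OF t, of 0] TL by simp
    moreover have "prim (\<lambda>\<eta>. \<rho> (x - \<eta>) \<eta> * Ue t (x - 2 * \<eta>) + k (x - \<eta>) \<eta> * U\<^sub>2 t (x - 2 * \<eta>)) (x / 2)
      = prim (\<lambda>\<eta>. k (x - \<eta>) \<eta> * (Q x * Ue t (x - 2 * \<eta>) + \<sigma> * Ud t (x - 2 * \<eta>))) (x / 2)"
    proof (rule prim_cong)
      fix \<eta> assume \<eta>: "\<eta> \<in> {0..x / 2}"
      have r: "\<rho> (x - \<eta>) \<eta> = (Q x - P (x - 2 * \<eta>)) * k (x - \<eta>) \<eta>"
        using \<eta> x X k_eq_\<kappa> [of "x - \<eta>" \<eta>] by (simp add: \<rho>_def)
      have u: "U\<^sub>2 t (x - 2 * \<eta>) = \<sigma> * Ud t (x - 2 * \<eta>) + P (x - 2 * \<eta>) * Ue t (x - 2 * \<eta>)"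
        using eU [OF t, of "x - 2 * \<eta>"] \<eta> x X by simp
      show "\<rho> (x - \<eta>) \<eta> * Ue t (x - 2 * \<eta>) + k (x - \<eta>) \<eta> * U\<^sub>2 t (x - 2 * \<eta>)
        = k (x - \<eta>) \<eta> * (Q x * Ue t (x - 2 * \<eta>) + \<sigma> * Ud t (x - 2 * \<eta>))"
        unfolding r u by algebra
    qed (use x in auto)
    moreover have "Ue t x = U t x" using eU [OF t] x X by simp
    ultimately show ?thesis by (simp add: N_def)
  qed
  have N_eq': "N t x = (Q x - P x) * U t x + Q x * W t x + \<sigma> * Wd t x"
    if t: "t \<in> {0..T}" and x: "x \<in> {0..X}" for t x
  proof -
    have c: "continuous_on UNIV (\<lambda>\<eta>. k (x - \<eta>) \<eta> * Ue t (x - 2 * \<eta>))"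
       "continuous_on UNIV (\<lambda>\<eta>. k (x - \<eta>) \<eta> * Ud t (x - 2 * \<eta>))"
      by (intro continuous_on_mult continuous_on_comp2 [OF k_cont] joint_contD [OF cU(1)]
          joint_contD [OF cU(3)] continuous_intros)+
    have "prim (\<lambda>\<eta>. k (x - \<eta>) \<eta> * (Q x * Ue t (x - 2 * \<eta>) + \<sigma> * Ud t (x - 2 * \<eta>))) (x / 2)
       = prim (\<lambda>\<eta>. Q x * (k (x - \<eta>) \<eta> * Ue t (x - 2 * \<eta>)) + \<sigma> * (k (x - \<eta>) \<eta> * Ud t (x - 2 * \<eta>))) (x / 2)"
      by (simp add: algebra_simps)
    also have "\<dots> = Q x * prim (\<lambda>\<eta>. k (x - \<eta>) \<eta> * Ue t (x - 2 * \<eta>)) (x / 2)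
       + \<sigma> * prim (\<lambda>\<eta>. k (x - \<eta>) \<eta> * Ud t (x - 2 * \<eta>)) (x / 2)"
      unfolding prim_add [OF continuous_on_mult [OF continuous_on_const c(1)]
          continuous_on_mult [OF continuous_on_const c(2)]] prim_mult_left ..
    finally show ?thesis
      unfolding N_eq [OF t x] by (simp add: W_def Wd_def transform_def algebra_simps)
  qed
  define Z where "Z t x = Ve t x - Ue t x - W t x" for t x
  define G where "G t x = Vd t x - Ud t x - Wd t x" for t x
  have cZ: "joint_cont Z" and cG: "joint_cont G"
    unfolding joint_cont_def Z_def G_def
    by (intro continuous_on_diff continuous_intros joint_contD [OF cU(1)] joint_contD [OF cU(3)]
        joint_contD [OF cV(1)] joint_contD [OF cV(3)] joint_contD [OF cW(1)] joint_contD [OF cW(2)])+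
  interpret lateral_problem X T \<sigma> Q q
    using X Q_cont Q_le by unfold_locales auto
  have Z0: "Z t x = 0" if t: "t \<in> {0..T}" and x: "x \<in> {0..X}" for t x
  proof (rule lateral_uniqueness [OF cZ cG _ _ t x T])
    fix t x assume t: "t \<in> {0..T}" and x: "x \<in> {0..X}"
    have D1: "prim (\<lambda>y. V\<^sub>2 t y - U\<^sub>2 t y) = (\<lambda>y. V\<^sub>1 t y - U\<^sub>1 t y)"
      using prim_eq_diff_at [OF has_vector_derivative_diff [OF dV(2) dU(2)], of t t]
        lateral [OF t] eU [OF t, of 0] eV [OF t, of 0] TL by (simp add: fun_eq_iff)
    have D0: "prim (prim (\<lambda>y. V\<^sub>2 t y - U\<^sub>2 t y)) = (\<lambda>y. Ve t y - Ue t y)"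
      unfolding D1
      using prim_eq_diff_at [OF has_vector_derivative_diff [OF dV(1) dU(1)], of t t]
        lateral [OF t] eU [OF t, of 0] eV [OF t, of 0] TL by (simp add: fun_eq_iff)
    have c: "continuous_on UNIV (\<lambda>y. V\<^sub>2 t y - U\<^sub>2 t y)"
      by (intro continuous_intros sl cU cV)
    have c': "continuous_on UNIV (prim f)" if "continuous_on UNIV f" for f :: "real \<Rightarrow> complex"
      by (rule continuous_on_if_vderiv [OF has_vector_derivative_prim [OF that]])
    have "prim (\<lambda>y. (V\<^sub>2 t y - U\<^sub>2 t y) - N t y)
        = (\<lambda>x. prim (\<lambda>y. V\<^sub>2 t y - U\<^sub>2 t y) x - prim (N t) x)"
      using prim_diff [OF c N_cont] by (simp add: fun_eq_iff)
    then have "Z t x = prim (prim (\<lambda>y. (V\<^sub>2 t y - U\<^sub>2 t y) - N t y)) x"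
      using prim_diff [OF c' [OF c] c' [OF N_cont], of t x] by (simp add: D0 Z_def W_eq)
    also have "\<dots> = prim (prim (\<lambda>y. \<sigma> * G t y + Q y * Z t y)) x"
    proof (rule prim_prim_cong)
      fix y assume y: "y \<in> {0..x}"
      then show "(V\<^sub>2 t y - U\<^sub>2 t y) - N t y = \<sigma> * G t y + Q y * Z t y"
        using eU [OF t, of y] eV [OF t, of y] N_eq' [OF t, of y] x X
        by (simp add: G_def Z_def algebra_simps)
    qed (use x in auto)
    finally show "Z t x = prim (prim (\<lambda>y. \<sigma> * G t y + Q y * Z t y)) x" .
  next
    fix t h x :: real assume h: "0 < h" and t: "t \<in> {0..T}" "t + h \<in> {0..T}" and x: "x \<in> {0..X}"
    have aU: "time_average h Ud t y = time_quotient h Ue t y" if "y \<in> {0..L}" for y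
      by (rule time_average_of_derivative [OF U h t that]) (use eU that in auto)
    have aV: "time_average h Vd t y = time_quotient h Ve t y" if "y \<in> {0..L}" for y
      by (rule time_average_of_derivative [OF V h t that]) (use eV that in auto)
    have aW: "time_average h Wd t x = time_quotient h W t x"
      unfolding Wd_def W_def transform_time_average [OF cU(3)] transform_time_quotient [OF cU(1)]
      by (rule transform_cong) (use aU x X in auto)
    have c: "continuous_on UNIV (\<lambda>\<theta>. F (t + h * \<theta>) x)" if "joint_cont F" for F
      by (intro joint_contD [OF that] continuous_intros)
    have "time_average h G t x = time_average h Vd t x - time_average h Ud t x - time_average h Wd t x"
      unfolding time_average_def G_def prim_diff [OF continuous_on_diff [OF c [OF cV(3)] c [OF cU(3)]] c [OF cW(2)]]
        prim_diff [OF c [OF cV(3)] c [OF cU(3)]] ..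
    also have "\<dots> = time_quotient h Z t x"
    proof -
      have "x \<in> {0..L}" using x X by simp
      then show ?thesis
        unfolding aU [OF \<open>x \<in> {0..L}\<close>] aV [OF \<open>x \<in> {0..L}\<close>] aW time_quotient_def Z_def divide_inverse
        by algebra
    qed
    finally show "time_average h G t x = time_quotient h Z t x" .
  qed
  have W0: "prim (prim (N t\<^sub>0)) x = 0" if "x \<in> {0<..<X}" for x
    using Z0 [OF t\<^sub>0, of x] that eU [OF t\<^sub>0, of x] eV [OF t\<^sub>0, of x] initial [of x] X
    by (simp add: Z_def W_eq)
  \<comment> \<open>a double primitive that vanishes on an open interval has vanishing integrand there\<close>
  have N0: "N t\<^sub>0 x = 0" if "x \<in> {0<..<X}" for x
    by (rule prim_eq_0_imp_eq_0 [OF N_cont _ that],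
        rule prim_eq_0_imp_eq_0 [OF continuous_on_if_vderiv [OF has_vector_derivative_prim [OF N_cont]]])
       (use W0 in auto)
  show thesis
  proof (rule that)
    show "joint_cont e"
      unfolding joint_cont_def e_def
      by (intro continuous_on_add continuous_on_mult continuous_on_comp [OF Q_cont] continuous_intros
          joint_contD [OF cU(1)] joint_contD [OF cU(3)])
    show "(Q x - P x) * U t\<^sub>0 x = - 2 * prim (\<lambda>\<eta>. k (x - \<eta>) \<eta> * e x \<eta>) (x / 2)"
      if x: "x \<in> {0<..<X}" for x
      using N0 [OF x] N_eq [OF t\<^sub>0, of x] x unfolding e_def
      by (simp add: add_eq_0_iff2)
  qed
qed

end

section \<open>Continuation of the equality of the potentials\<close>

lemma prim_shift:
  fixes f :: "real \<Rightarrow> complex"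
  assumes f: "continuous_on UNIV f"
  shows "prim f y = prim f a + prim (\<lambda>s. f (a + s)) (y - a)"
proof -
  have "prim (\<lambda>s. f (a + s)) (y - a) = prim f (a + (y - a)) - prim f (a + 0)"
  proof (rule prim_eq_diff_at)
    show "((\<lambda>s. prim f (a + s)) has_vector_derivative f (a + s)) (at s)" for s
      using has_vector_derivative_prim_comp [OF f, of "\<lambda>s. a + s" 1 s UNIV]
      by (simp add: DERIV_add [OF DERIV_const DERIV_ident, simplified])
  qed
  then show ?thesis by simp
qed

lemma continuous_on_shift: "continuous_on UNIV f \<Longrightarrow> continuous_on UNIV (\<lambda>s::real. f (a + s))"
  by (rule continuous_on_comp [of f]) (auto intro: continuous_intros)

lemma prim_eq_0_if_zero_before:
  fixes f :: "real \<Rightarrow> complex"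
  assumes a: "0 \<le> a" and f: "continuous_on UNIV f" and 0: "\<And>s. s \<in> {0..<a} \<Longrightarrow> f s = 0"
  shows "prim f a = 0"
proof (cases "a = 0")
  case False
  have "f s = 0" if "s \<in> closure {0..<a}" for s
    by (rule continuous_constant_on_closure [OF continuous_on_subset [OF f] 0 that]) auto
  then have "f s = 0" if "s \<in> {0..a}" for s
    using that a False by (simp add: closure_atLeastLessThan)
  then have "prim f a = prim (\<lambda>_. 0) a" using a by (intro prim_cong) auto
  then show ?thesis by simp
qed simp

lemma norm_prim_le_if_zero_before:
  fixes f :: "real \<Rightarrow> complex"
  assumes a: "0 \<le> a" "a \<le> y" and f: "continuous_on UNIV f"
    and 0: "\<And>s. s \<in> {0..<a} \<Longrightarrow> f s = 0" and le: "\<And>s. s \<in> {a..y} \<Longrightarrow> norm (f s) \<le> F"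
  shows "norm (prim f y) \<le> F * (y - a)"
proof -
  have "prim f y = prim (\<lambda>s. f (a + s)) (y - a)"
    using prim_shift [OF f, of y a] prim_eq_0_if_zero_before [OF a(1) f 0] by simp
  also have "norm \<dots> \<le> F * (y - a)"
    by (rule norm_prim_le_const) (use a in \<open>auto intro!: le continuous_on_shift f\<close>)
  finally show ?thesis .
qed

lemma norm_prim_le_if_zero_after:
  fixes f :: "real \<Rightarrow> complex"
  assumes c: "0 \<le> c" "0 \<le> y" and f: "continuous_on UNIV f"
    and 0: "\<And>s. s \<in> {c..y} \<Longrightarrow> f s = 0" and le: "\<And>s. s \<in> {0..y} \<Longrightarrow> norm (f s) \<le> F"
  shows "norm (prim f y) \<le> F * c"
proof (cases "y \<le> c")
  case True
  have F: "0 \<le> F" using order_trans [OF norm_ge_zero le [of 0]] c by simp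
  have "norm (prim f y) \<le> F * y"
    by (rule norm_prim_le_const [OF c(2) f le])
  also have "\<dots> \<le> F * c" using True F by (rule mult_left_mono)
  finally show ?thesis .
next
  case False
  have "prim (\<lambda>s. f (c + s)) (y - c) = prim (\<lambda>_. 0) (y - c)"
    using False c 0 by (intro prim_cong) auto
  then have "prim f y = prim f c" using prim_shift [OF f, of y c] by simp
  also have "norm \<dots> \<le> F * c"
    by (rule norm_prim_le_const [OF c(1) f le]) (use False in auto)
  finally show ?thesis .
qed

text \<open>
  Only a linear lower bound is used, so points where \<open>u\<close> does not vanish and simple zeros can be
  treated alike.
\<close>

lemma simple_zero_lower_bound:
  fixes u :: "real \<Rightarrow> complex"
  assumes u: "(u has_vector_derivative d) (at x\<^sub>0 within S)" and nz: "u x\<^sub>0 = 0 \<longrightarrow> d \<noteq> 0"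
  obtains c \<delta> where "0 < c" "0 < \<delta>"
    "\<And>x. x \<in> S \<Longrightarrow> \<bar>x - x\<^sub>0\<bar> < \<delta> \<Longrightarrow> c * \<bar>x - x\<^sub>0\<bar> \<le> norm (u x)"
proof (cases "u x\<^sub>0 = 0")
  case True
  then have d: "0 < norm d / 2" using nz by simp
  obtain \<delta> where \<delta>: "0 < \<delta>" "\<And>x. x \<in> S \<Longrightarrow> norm (x - x\<^sub>0) < \<delta> \<Longrightarrow>
      norm (u x - u x\<^sub>0 - (x - x\<^sub>0) *\<^sub>R d) \<le> norm d / 2 * norm (x - x\<^sub>0)"
    using u d unfolding has_vector_derivative_def has_derivative_within_alt by blast
  have "norm d / 2 * \<bar>x - x\<^sub>0\<bar> \<le> norm (u x)" if "x \<in> S" "\<bar>x - x\<^sub>0\<bar> < \<delta>" for x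
  proof -
    let ?w = "(x - x\<^sub>0) *\<^sub>R d"
    have "norm (u x - ?w) \<le> norm d / 2 * \<bar>x - x\<^sub>0\<bar>"
      using \<delta>(2) [of x] that True by simp
    moreover have "norm ?w \<le> norm (u x) + norm (u x - ?w)"
      using norm_triangle_sub [of ?w "u x"] by (simp only: norm_minus_commute)
    moreover have "norm ?w = norm d * \<bar>x - x\<^sub>0\<bar>" by simp
    ultimately show ?thesis by linarith
  qed
  with d \<delta>(1) show ?thesis by (rule that)
next
  case False
  then have d: "0 < norm (u x\<^sub>0) / 2" by simp
  have "continuous (at x\<^sub>0 within S) u" by (rule has_vector_derivative_continuous [OF u])
  then obtain \<delta> where \<delta>: "0 < \<delta>" "\<And>x. x \<in> S \<Longrightarrow> dist x x\<^sub>0 < \<delta> \<Longrightarrow> dist (u x) (u x\<^sub>0) < norm (u x\<^sub>0) / 2"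
    using d unfolding continuous_within_eps_delta by blast
  have "norm (u x\<^sub>0) / 2 * \<bar>x - x\<^sub>0\<bar> \<le> norm (u x)" if "x \<in> S" "\<bar>x - x\<^sub>0\<bar> < min \<delta> 1" for x
  proof -
    have "norm (u x\<^sub>0) / 2 * \<bar>x - x\<^sub>0\<bar> \<le> norm (u x\<^sub>0) / 2 * 1"
      using that by (intro mult_left_mono) auto
    also have "\<dots> \<le> norm (u x)"
      using \<delta>(2) [of x] that norm_triangle_ineq2 [of "u x\<^sub>0" "u x"]
      by (simp add: dist_norm norm_minus_commute)
    finally show ?thesis .
  qed
  moreover have "0 < min \<delta> 1" using \<delta> by simp
  ultimately show ?thesis using d that by blast
qed

lemma zero_by_continuation:
  fixes f :: "real \<Rightarrow> complex"
  assumes f: "continuous_on UNIV f" and L: "0 < L" and a: "0 \<le> a" "a \<le> L"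
    and start: "\<And>y. y \<in> {0..<a} \<Longrightarrow> f y = 0"
    and step: "\<And>b. a \<le> b \<Longrightarrow> b < L \<Longrightarrow> (\<And>y. y \<in> {0..<b} \<Longrightarrow> f y = 0) \<Longrightarrow>
      \<exists>\<delta>>0. \<forall>y\<in>{0..<b + \<delta>}. f y = 0"
    and x: "x \<in> {0..L}"
  shows "f x = 0"
proof -
  define S where "S = {b\<in>{a..L}. \<forall>y\<in>{0..<b}. f y = 0}"
  define s where "s = Sup S"
  have aS: "a \<in> S" using a start by (auto simp: S_def)
  have bdd: "bdd_above S" by (auto simp: S_def)
  have s: "a \<le> s" "s \<le> L"
    unfolding s_def using aS bdd by (auto intro: cSup_upper cSup_least simp: S_def)
  have before: "f y = 0" if y: "y \<in> {0..<s}" for y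
  proof -
    obtain b where "b \<in> S" "y < b"
      using y less_cSup_iff [OF _ bdd, of y] aS unfolding s_def by auto
    then show ?thesis using y by (auto simp: S_def)
  qed
  have "s = L"
  proof (rule ccontr)
    assume "s \<noteq> L"
    then obtain \<delta> where \<delta>: "\<delta> > 0" "\<forall>y\<in>{0..<s + \<delta>}. f y = 0"
      using step [OF s(1)] s before by force
    then have "min (s + \<delta>) L \<in> S" using s by (auto simp: S_def)
    then have "min (s + \<delta>) L \<le> s" unfolding s_def using bdd by (rule cSup_upper)
    then show False using \<delta> \<open>s \<noteq> L\<close> s by auto
  qed
  have "f y = 0" if "y \<in> closure {0..<L}" for y
    by (rule continuous_constant_on_closure [OF continuous_on_subset [OF f] _ that])
       (use before \<open>s = L\<close> in auto)
  then show ?thesis using x L by (simp add: closure_atLeastLessThan)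
qed

context kernel
begin

lemma k_eq_0:
  assumes x\<^sub>0: "0 \<le> x\<^sub>0" "x\<^sub>0 \<le> L" and before: "\<And>y. y \<in> {0..<x\<^sub>0} \<Longrightarrow> Q y - P y = 0"
    and "\<xi> \<in> {0..x\<^sub>0}" "\<eta> \<in> {0..x\<^sub>0}"
  shows "k \<xi> \<eta> = 0"
proof -
  have "prim (\<lambda>y. (Q y - P y) / 2) y = 0" if "y \<in> {0..x\<^sub>0}" for y
    by (rule prim_eq_0_if_zero_before [OF _ half_diff_cont]) (use that before in auto)
  then have "norm (k \<xi> \<eta>) \<le> 4 * exp (\<mu> * L) * 0"
    using assms by (intro norm_k_le [of x\<^sub>0]) auto
  then show ?thesis by simp
qed

text \<open>
  To the right of \<open>x\<^sub>0\<close> the kernel is bounded by \<open>C F (x - x\<^sub>0)\<close>, where \<open>F\<close> is the maximum of \<open>|Q - P|/2\<close> over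
  \<open>[x\<^sub>0, x\<^sub>0 + \<delta>]\<close>, and the integrand is zero for \<open>\<eta> \<ge> x - x\<^sub>0\<close>. After division by \<open>c (x - x\<^sub>0)\<close> one factor
  \<open>x - x\<^sub>0\<close> is left; for small \<open>\<delta>\<close> it makes \<open>|Q - P|/2 \<le> F/2\<close>, so \<open>F = 0\<close>.
\<close>

lemma continuation_step:
  assumes x\<^sub>0: "0 \<le> x\<^sub>0" "x\<^sub>0 < X" "X \<le> L"
    and before: "\<And>y. y \<in> {0..<x\<^sub>0} \<Longrightarrow> Q y - P y = 0"
    and e: "joint_cont e"
    and eq: "\<And>x. x \<in> {0<..<X} \<Longrightarrow>
      (Q x - P x) * B x = - 2 * prim (\<lambda>\<eta>. k (x - \<eta>) \<eta> * e x \<eta>) (x / 2)"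
    and c: "0 < c" and d: "0 < d"
    and B: "\<And>x. x \<in> {0..L} \<Longrightarrow> \<bar>x - x\<^sub>0\<bar> < d \<Longrightarrow> c * \<bar>x - x\<^sub>0\<bar> \<le> norm (B x)"
  shows "\<exists>\<delta>>0. \<forall>y\<in>{0..<x\<^sub>0 + \<delta>}. Q y - P y = 0"
proof -
  define h where "h y = (Q y - P y) / 2" for y
  have h: "continuous_on UNIV h" unfolding h_def [abs_def] by (rule half_diff_cont)
  have h0: "h y = 0" if "y \<in> {0..<x\<^sub>0}" for y using before [OF that] by (simp add: h_def)
  have "compact ((\<lambda>q. e (fst q) (snd q)) ` ({0..L} \<times> {0..L}))"
    by (intro compact_continuous_image compact_Times joint_contD [OF e] continuous_intros) auto
  then obtain E where E: "0 < E" "\<And>x \<eta>. x \<in> {0..L} \<Longrightarrow> \<eta> \<in> {0..L} \<Longrightarrow> norm (e x \<eta>) \<le> E"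
    by (force dest!: compact_imp_bounded simp: bounded_pos)
  define C where "C = 4 * exp (\<mu> * L) * E"
  have C: "0 < C" using E by (simp add: C_def)
  \<comment> \<open>\<open>C F (x - x\<^sub>0)\<^sup>2\<close> will bound \<open>|h(x) B(x)|\<close>, so \<open>c / (2 C)\<close> is the length at which \<open>F\<close> gets halved\<close>
  define \<delta> where "\<delta> = min (min (d / 2) (X - x\<^sub>0)) (c / (2 * C))"
  have \<delta>: "0 < \<delta>" "\<delta> < d" "x\<^sub>0 + \<delta> \<le> X" "\<delta> \<le> c / (2 * C)"
    using C c d x\<^sub>0 by (auto simp: \<delta>_def)
  have "continuous_on {x\<^sub>0..x\<^sub>0 + \<delta>} (\<lambda>y. norm (h y))"
    by (intro continuous_intros continuous_on_subset [OF h]) auto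
  from continuous_attains_sup [OF _ _ this] \<delta> obtain z where z: "z \<in> {x\<^sub>0..x\<^sub>0 + \<delta>}"
    and max: "\<And>y. y \<in> {x\<^sub>0..x\<^sub>0 + \<delta>} \<Longrightarrow> norm (h y) \<le> norm (h z)"
    by auto
  define F where "F = norm (h z)"
  have F: "0 \<le> F" by (simp add: F_def)
  have half: "norm (h x) \<le> F / 2" if x: "x \<in> {x\<^sub>0<..<x\<^sub>0 + \<delta>}" for x
  proof -
    have xX: "x \<in> {0<..<X}" and xL: "0 \<le> x" "x \<le> L" and xd: "0 < x - x\<^sub>0" "x - x\<^sub>0 < \<delta>"
      using x x\<^sub>0 \<delta> by auto
    have ph: "norm (prim (\<lambda>y. (Q y - P y) / 2) y) \<le> F * (x - x\<^sub>0)" if y: "y \<in> {0..x}" for y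
    proof (cases "y \<le> x\<^sub>0")
      case True
      then have "prim h y = 0"
        using y by (intro prim_eq_0_if_zero_before h h0) auto
      then show ?thesis using F xd by (simp add: h_def [abs_def])
    next
      case False
      have "norm (prim h y) \<le> F * (y - x\<^sub>0)"
        by (rule norm_prim_le_if_zero_before [OF _ _ h h0])
           (use False x\<^sub>0 y x in \<open>auto intro!: max simp: F_def\<close>)
      also have "\<dots> \<le> F * (x - x\<^sub>0)" using y F by (intro mult_left_mono) auto
      finally show ?thesis by (simp add: h_def [abs_def])
    qed
    have "norm (prim (\<lambda>\<eta>. k (x - \<eta>) \<eta> * e x \<eta>) (x / 2))
        \<le> (4 * exp (\<mu> * L) * (F * (x - x\<^sub>0)) * E) * (x - x\<^sub>0)"
    proof (rule norm_prim_le_if_zero_after)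
      show "continuous_on UNIV (\<lambda>\<eta>. k (x - \<eta>) \<eta> * e x \<eta>)"
        by (intro continuous_on_mult continuous_on_comp2 [OF k_cont] joint_contD [OF e] continuous_intros)
      show "k (x - \<eta>) \<eta> * e x \<eta> = 0" if "\<eta> \<in> {x - x\<^sub>0..x / 2}" for \<eta>
        using k_eq_0 [OF _ _ before, of x\<^sub>0 "x - \<eta>" \<eta>] that x x\<^sub>0 by auto
      show "norm (k (x - \<eta>) \<eta> * e x \<eta>) \<le> 4 * exp (\<mu> * L) * (F * (x - x\<^sub>0)) * E"
        if "\<eta> \<in> {0..x / 2}" for \<eta>
        unfolding norm_mult
        by (intro mult_mono norm_k_le [OF xL ph] E) (use that xL xd F in auto)
    qed (use xL xd in auto)
    then have "2 * norm (prim (\<lambda>\<eta>. k (x - \<eta>) \<eta> * e x \<eta>) (x / 2)) \<le> 2 * (C * F * (x - x\<^sub>0) ^ 2)"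
      by (simp add: C_def power2_eq_square mult_ac)
    also have "2 * norm (prim (\<lambda>\<eta>. k (x - \<eta>) \<eta> * e x \<eta>) (x / 2)) = 2 * (norm (h x) * norm (B x))"
      using arg_cong [OF eq [OF xX], of norm] by (simp add: h_def norm_mult norm_divide)
    finally have hB: "norm (h x) * norm (B x) \<le> C * F * (x - x\<^sub>0) ^ 2" by simp
    have "norm (h x) * (c * (x - x\<^sub>0)) \<le> norm (h x) * norm (B x)"
      using B [of x] xL xd \<delta> by (intro mult_left_mono) auto
    with hB have "(norm (h x) * c) * (x - x\<^sub>0) \<le> (C * F * (x - x\<^sub>0)) * (x - x\<^sub>0)"
      by (simp add: power2_eq_square mult_ac)
    then have "norm (h x) * c \<le> C * F * (x - x\<^sub>0)"
      using xd by (simp only: mult_le_cancel_right_pos)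
    also have "\<dots> \<le> C * F * (c / (2 * C))"
      using xd \<delta> C F by (intro mult_left_mono) auto
    also have "\<dots> = F / 2 * c" using C by simp
    finally show ?thesis using c by simp
  qed
  have "norm (h z) \<le> F / 2"
  proof (rule continuous_le_on_closure [where S = "{x\<^sub>0<..<x\<^sub>0 + \<delta>}" and f = "\<lambda>x. norm (h x)"])
    show "continuous_on (closure {x\<^sub>0<..<x\<^sub>0 + \<delta>}) (\<lambda>x. norm (h x))"
      by (intro continuous_intros continuous_on_subset [OF h]) auto
    show "z \<in> closure {x\<^sub>0<..<x\<^sub>0 + \<delta>}" using z \<delta> by (simp add: closure_greaterThanLessThan)
  qed (use half in auto)
  then have "F = 0" using F by (simp add: F_def)
  then have "h y = 0" if "y \<in> {0..<x\<^sub>0 + \<delta>}" for y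
    using h0 [of y] max [of y] that by (cases "y < x\<^sub>0") (auto simp: F_def)
  then have "\<forall>y\<in>{0..<x\<^sub>0 + \<delta>}. Q y - P y = 0"
    by (simp add: h_def)
  then show ?thesis using \<delta>(1) by blast
qed

end

lemma goursat_kernel_exists:
  assumes L: "0 \<le> L" and P: "continuous_on UNIV P" and Q: "continuous_on UNIV Q"
    and le: "\<And>x. norm (P x) \<le> q" "\<And>x. norm (Q x) \<le> q"
  obtains r \<mu> \<kappa> where "kernel L r \<mu> P Q \<gamma> \<kappa>"
proof -
  define r where "r = 2 * q"
  define \<mu> where "\<mu> = 1 + 2 * (2 * r + norm \<gamma> + 2 * L * r)"
  have R: "continuous_on UNIV (\<lambda>q. Q (fst q + snd q) - P (fst q - snd q))"
    by (intro continuous_intros continuous_on_comp [OF P] continuous_on_comp [OF Q])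
  have "norm (Q x - P y) \<le> r" for x y
    using norm_triangle_ineq4 [of "Q x" "P y"] le(1) [of y] le(2) [of x] by (simp add: r_def)
  then interpret g: goursat L r \<mu> "\<lambda>\<xi> \<eta>. Q (\<xi> + \<eta>) - P (\<xi> - \<eta>)" \<gamma>
    using L R by unfold_locales (auto simp: \<mu>_def)
  have h: "continuous_on UNIV (\<lambda>y. (Q y - P y) / 2)"
    by (intro continuous_intros P Q) simp
  have "continuous_on UNIV (\<lambda>x. prim (\<lambda>y. (Q y - P y) / 2) (fst x) + prim (\<lambda>y. (Q y - P y) / 2) (snd x))"
    by (intro continuous_on_add continuous_on_prim continuous_on_comp [OF h] continuous_intros)
  from g.volterra_solution_exists [of "\<lambda>\<xi> \<eta>. prim (\<lambda>y. (Q y - P y) / 2) \<xi> + prim (\<lambda>y. (Q y - P y) / 2) \<eta>", OF this]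
  obtain \<kappa> where "continuous_on UNIV (\<lambda>q. \<kappa> (fst q) (snd q))"
    "\<And>\<xi> \<eta>. \<kappa> \<xi> \<eta> = prim (\<lambda>y. (Q y - P y) / 2) (clip L \<xi>)
      + prim (\<lambda>y. (Q y - P y) / 2) (clip L \<eta>) + g.volterra \<kappa> (clip L \<xi>) (clip L \<eta>)"
    by blast
  then have "kernel L r \<mu> P Q \<gamma> \<kappa>"
    using P Q by unfold_locales
  then show thesis by (rule that)
qed

text \<open>
  The two alternatives for the start differ only in where the boundary terms of the transform vanish:
  everywhere for Robin data, and for \<open>x \<le> 2 b\<close> once \<open>P = Q\<close> is known on \<open>[0,b)\<close>. In the second case
  \<open>b > 0\<close>, so the interval still grows in every step.
\<close>

lemma potentials_eq_unit_speed:
  assumes L: "0 < L" and T: "0 < T" and t\<^sub>0: "t\<^sub>0 \<in> {0..T}"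
    and P: "continuous_on {0..L} P" and Q: "continuous_on {0..L} Q"
    and U: "solves \<sigma> T L P U Ux Ut" and V: "solves \<sigma> T L Q V Vx Vt"
    and lateral: "\<And>t. t \<in> {0..T} \<Longrightarrow> U t 0 = V t 0 \<and> Ux t 0 = Vx t 0"
    and initial: "\<And>x. x \<in> {0..L} \<Longrightarrow> U t\<^sub>0 x = V t\<^sub>0 x"
    and simple: "\<And>x. x \<in> {0..L} \<Longrightarrow> U t\<^sub>0 x = 0 \<Longrightarrow> Ux t\<^sub>0 x \<noteq> 0"
    and start: "(\<exists>\<beta>. \<forall>t\<in>{0..T}. Ux t 0 = \<beta> * U t 0) \<or> (\<exists>\<epsilon>\<in>{0<..<L}. \<forall>x\<in>{0..\<epsilon>}. P x = Q x)"
    and x: "x \<in> {0..L}"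
  shows "P x = Q x"
proof -
  define P' where "P' x = P (clip L x)" for x
  define Q' where "Q' x = Q (clip L x)" for x
  have P': "continuous_on UNIV P'" and Q': "continuous_on UNIV Q'"
    unfolding P'_def Q'_def using L
    by (auto intro!: continuous_on_compose_clip P Q continuous_on_id)
  have U': "solves \<sigma> T L P' U Ux Ut" and V': "solves \<sigma> T L Q' V Vx Vt"
    using U V by (auto simp: solves_def P'_def Q'_def)
  obtain q where q: "\<And>x. norm (P' x) \<le> q" "\<And>x. norm (Q' x) \<le> q"
  proof -
    have "compact (P ` {0..L} \<union> Q ` {0..L})"
      by (intro compact_Un compact_continuous_image P Q) auto
    then obtain q where "\<And>z. z \<in> P ` {0..L} \<union> Q ` {0..L} \<Longrightarrow> norm z \<le> q"
      by (meson compact_imp_bounded bounded_iff)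
    then show thesis
      using L clip_bounds [of L] by (intro that [of q]) (auto simp: P'_def Q'_def)
  qed
  define robin where "robin \<beta> \<longleftrightarrow> (\<forall>t\<in>{0..T}. Ux t 0 = \<beta> * U t 0)" for \<beta>
  obtain a \<beta> where a: "0 \<le> a" "a \<le> L" "\<And>y. y \<in> {0..<a} \<Longrightarrow> Q' y - P' y = 0"
    and aR: "robin \<beta> \<or> 0 < a"
  proof (cases "\<exists>\<beta>. robin \<beta>")
    case True
    then obtain \<beta> where "robin \<beta>" by blast
    then show thesis using that [of 0 \<beta>] L by auto
  next
    case False
    with start obtain \<epsilon> where "\<epsilon> \<in> {0<..<L}" "\<forall>x\<in>{0..\<epsilon>}. P x = Q x" by (auto simp: robin_def)
    then show thesis using that [of \<epsilon> 0] by (auto simp: P'_def Q'_def)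
  qed
  \<comment> \<open>\<open>\<gamma> = - 2 \<beta>\<close> annihilates the boundary terms of the transform for Robin data\<close>
  obtain r \<mu> \<kappa> where "kernel L r \<mu> P' Q' (- 2 * \<beta>) \<kappa>"
    using goursat_kernel_exists [OF less_imp_le [OF L] P' Q' q] .
  then interpret kernel L r \<mu> P' Q' "- 2 * \<beta>" \<kappa> .
  have "Q' x - P' x = 0"
  proof (rule zero_by_continuation [OF continuous_on_diff [OF Q' P'] L a _ x])
    fix b assume b: "a \<le> b" "b < L" and before: "\<And>y. y \<in> {0..<b} \<Longrightarrow> Q' y - P' y = 0"
    \<comment> \<open>the range of \<open>x\<close> on which the boundary terms of the transform vanish\<close>
    define X where "X = (if robin \<beta> then L else min (2 * b) L)"
    have X: "0 \<le> X" "X \<le> L" "b < X" using L a b aR by (auto simp: X_def)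
    have "k (x / 2) (x / 2) * Ux t 0 + - 2 * \<beta> / 2 * \<kappa> (x / 2) (x / 2) * U t 0 = 0"
      if t: "t \<in> {0..T}" and x: "x \<in> {0..X}" for t x
    proof -
      have "\<kappa> (x / 2) (x / 2) = k (x / 2) (x / 2)"
        using x X by (intro k_eq_\<kappa> [symmetric]) auto
      moreover have "k (x / 2) (x / 2) = 0" if "\<not> robin \<beta>"
        by (rule k_eq_0 [OF _ _ before]) (use x X that a b in \<open>auto simp: X_def\<close>)
      ultimately show ?thesis using t by (cases "robin \<beta>") (auto simp: robin_def)
    qed
    then obtain e where e: "joint_cont e" and eq: "\<And>x. x \<in> {0<..<X} \<Longrightarrow>
      (Q' x - P' x) * U t\<^sub>0 x = - 2 * prim (\<lambda>\<eta>. k (x - \<eta>) \<eta> * e x \<eta>) (x / 2)"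
      using initial_integral_equation [OF T X(1,2) t\<^sub>0 q(2) U' V' lateral initial] by blast
    have "(U t\<^sub>0 has_vector_derivative Ux t\<^sub>0 b) (at b within {0..L})"
      using U t\<^sub>0 a b by (auto simp: solves_def)
    then obtain c d where cd: "0 < c" "0 < d"
      "\<And>x. x \<in> {0..L} \<Longrightarrow> \<bar>x - b\<bar> < d \<Longrightarrow> c * \<bar>x - b\<bar> \<le> norm (U t\<^sub>0 x)"
      using simple_zero_lower_bound [of "U t\<^sub>0" "Ux t\<^sub>0 b" b "{0..L}"] simple [of b] a b by auto
    show "\<exists>\<delta>>0. \<forall>y\<in>{0..<b + \<delta>}. Q' y - P' y = 0"
      by (rule continuation_step [OF _ X(3,2) before e eq cd]) (use a b in auto)
  qed
  then show ?thesis using x by (simp add: P'_def Q'_def)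
qed

section \<open>Liouville transformation to unit speed\<close>

lemma fourth_root_C2:
  assumes a: "C_k_on 2 a {0..l}" and pos: "\<And>x. x \<in> {0..l} \<Longrightarrow> a x > (0::real)"
  obtains E E\<^sub>1 E\<^sub>2 where
    "\<And>x. x \<in> {0..l} \<Longrightarrow> 0 < E x" "\<And>x. x \<in> {0..l} \<Longrightarrow> E x ^ 4 = a x"
    "\<And>x. x \<in> {0..l} \<Longrightarrow> (E has_real_derivative E\<^sub>1 x) (at x within {0..l})"
    "\<And>x. x \<in> {0..l} \<Longrightarrow> (E\<^sub>1 has_real_derivative E\<^sub>2 x) (at x within {0..l})"
    "continuous_on {0..l} E\<^sub>2"
proof -
  let ?S = "{0..l}"
  define a\<^sub>1 where "a\<^sub>1 x = vector_derivative a (at x within ?S)" for x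
  define a\<^sub>2 where "a\<^sub>2 x = vector_derivative a\<^sub>1 (at x within ?S)" for x
  have C: "\<And>x. x \<in> ?S \<Longrightarrow> a differentiable (at x within ?S)"
    "\<And>x. x \<in> ?S \<Longrightarrow> a\<^sub>1 differentiable (at x within ?S)" "continuous_on ?S a\<^sub>2"
    using a by (simp_all add: numeral_2_eq_2 a\<^sub>1_def [abs_def] a\<^sub>2_def [abs_def])
  have d1: "(a has_real_derivative a\<^sub>1 x) (at x within ?S)" if "x \<in> ?S" for x
    using C(1) [OF that] unfolding a\<^sub>1_def has_real_derivative_iff_has_vector_derivative
    by (simp add: vector_derivative_works)
  have d2: "(a\<^sub>1 has_real_derivative a\<^sub>2 x) (at x within ?S)" if "x \<in> ?S" for x
    using C(2) [OF that] unfolding a\<^sub>2_def has_real_derivative_iff_has_vector_derivative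
    by (simp add: vector_derivative_works)
  define E where "E x = sqrt (sqrt (a x))" for x
  define E\<^sub>1 where "E\<^sub>1 x = a\<^sub>1 x / (4 * E x ^ 3)" for x
  define E\<^sub>2 where "E\<^sub>2 x = (a\<^sub>2 x * (4 * E x ^ 3) - a\<^sub>1 x * (12 * E x ^ 2 * E\<^sub>1 x)) / (4 * E x ^ 3) ^ 2" for x
  have E_pos: "0 < E x" if "x \<in> ?S" for x using pos [OF that] by (simp add: E_def)
  have E_sq: "E x ^ 2 = sqrt (a x)" if "x \<in> ?S" for x using pos [OF that] by (simp add: E_def)
  have E4: "E x ^ 4 = a x" if "x \<in> ?S" for x
  proof -
    have "E x ^ 4 = (E x ^ 2) ^ 2" by (simp flip: power_mult)
    then show ?thesis using E_sq [OF that] pos [OF that] by simp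
  qed
  have dE: "(E has_real_derivative E\<^sub>1 x) (at x within ?S)" if x: "x \<in> ?S" for x
  proof -
    have "((\<lambda>x. sqrt (sqrt (a x))) has_real_derivative
        inverse (sqrt (sqrt (a x))) / 2 * (inverse (sqrt (a x)) / 2 * a\<^sub>1 x)) (at x within ?S)"
      using pos [OF x] by (intro DERIV_chain2 [OF DERIV_real_sqrt] d1 x) simp_all
    moreover have "inverse (sqrt (sqrt (a x))) / 2 * (inverse (sqrt (a x)) / 2 * a\<^sub>1 x) = E\<^sub>1 x"
      unfolding E_sq [OF x, symmetric] E_def [of x, symmetric] E\<^sub>1_def using E_pos [OF x]
      by (simp add: field_simps power2_eq_square power3_eq_cube)
    ultimately show ?thesis unfolding E_def [abs_def] by simp
  qed
  have dE1: "(E\<^sub>1 has_real_derivative E\<^sub>2 x) (at x within ?S)" if x: "x \<in> ?S" for x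
    unfolding E\<^sub>1_def [abs_def] E\<^sub>2_def using E_pos [OF x]
    by (auto intro!: derivative_eq_intros d2 [OF x] dE [OF x] simp: E\<^sub>1_def power2_eq_square)
  have "continuous_on ?S E" "continuous_on ?S E\<^sub>1" "continuous_on ?S a\<^sub>1"
    by (rule DERIV_continuous_on, erule dE dE1 d2)+
  then have "continuous_on ?S E\<^sub>2"
    unfolding E\<^sub>2_def [abs_def] using C(3) E_pos by (intro continuous_intros) force+
  with E_pos E4 dE dE1 show thesis by (rule that)
qed

text \<open>
  \<open>X\<close> is the inverse of \<open>x \<mapsto> \<integral>\<^sub>0\<^sup>x dy / E(y)\<^sup>2\<close>. Since the integrand is extended to the whole line, the
  inverse function theorem for open sets also covers the endpoints.
\<close>

lemma travel_time_coordinate: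
  assumes l: "0 < l" and E: "continuous_on {0..l} E" and pos: "\<And>x. x \<in> {0..l} \<Longrightarrow> (0::real) < E x"
  obtains L X where "0 < L" "X 0 = 0" "X L = l"
    "\<And>s. s \<in> {0..L} \<Longrightarrow> X s \<in> {0..l}" "\<And>x. x \<in> {0..l} \<Longrightarrow> \<exists>s\<in>{0..L}. X s = x"
    "\<And>s s'. s \<in> {0..L} \<Longrightarrow> s' \<in> {0..L} \<Longrightarrow> s \<le> s' \<Longrightarrow> X s \<le> X s'"
    "\<And>s. s \<in> {0..L} \<Longrightarrow> (X has_real_derivative E (X s) ^ 2) (at s within {0..L})"
proof -
  define g where "g y = 1 / E (clip l y) ^ 2" for y
  have Ec: "0 < E (clip l y)" for y using pos clip_bounds [of l y] l by simp
  have g: "continuous_on UNIV g"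
    unfolding g_def using E l Ec
    by (intro continuous_intros continuous_on_compose_clip) (auto simp: less_imp_neq [THEN not_sym])
  define S where "S = prim g"
  define X where "X = inv S"
  have dS: "(S has_real_derivative g x) (at x)" for x
    unfolding S_def has_real_derivative_iff_has_vector_derivative
    by (rule has_vector_derivative_prim [OF g])
  have S_less: "S x < S y" if "x < y" for x y
    using DERIV_pos_imp_increasing [OF that, of S] dS Ec by (metis g_def zero_less_divide_1_iff zero_less_power)
  then have "inj S" by (metis injI less_irrefl linorder_neqE_linordered_idom)
  then have XS: "X (S x) = x" for x by (simp add: X_def)
  have contS: "continuous_on A S" for A
    by (rule continuous_on_subset [OF DERIV_continuous_on [of UNIV]]) (use dS in auto)
  have S0: "S 0 = 0" by (simp add: S_def)
  have img: "\<exists>x\<in>{0..l}. S x = s" if "s \<in> {0..S l}" for s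
    using IVT' [of S 0 s l] that l S0 contS by fastforce
  have S_le: "S x \<le> S y \<longleftrightarrow> x \<le> y" for x y
    using S_less by (metis less_le_not_le linorder_le_less_linear order_le_less)
  show thesis
  proof (rule that [of "S l" X])
    show "0 < S l" using S_less [OF l] S0 by simp
    show "X 0 = 0" using XS [of 0] S0 by simp
    show "X (S l) = l" by (rule XS)
    show "X s \<in> {0..l}" if "s \<in> {0..S l}" for s using img [OF that] XS by auto
    show "\<exists>s\<in>{0..S l}. X s = x" if "x \<in> {0..l}" for x
      using that S_le [of 0 x] S_le [of x l] S0 XS by (intro bexI [of _ "S x"]) auto
    show "X s \<le> X s'" if "s \<in> {0..S l}" "s' \<in> {0..S l}" "s \<le> s'" for s s'
      using img [OF that(1)] img [OF that(2)] that(3) XS S_le by auto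
    show "(X has_real_derivative E (X s) ^ 2) (at s within {0..S l})" if s: "s \<in> {0..S l}" for s
    proof -
      obtain x where x: "x \<in> {0..l}" "S x = s" using img [OF s] by blast
      have gE: "g x = 1 / E x ^ 2" using x by (simp add: g_def)
      have "(X has_derivative (\<lambda>h. E x ^ 2 * h)) (at (S x))"
      proof (rule has_derivative_inverse_strong [of UNIV x S X "\<lambda>h. g x * h"])
        show "(S has_derivative (\<lambda>h. g x * h)) (at x)"
          using dS [of x] by (simp add: has_field_derivative_def)
        show "(\<lambda>h. g x * h) \<circ> (\<lambda>h. E x ^ 2 * h) = id"
          using pos [OF x(1)] by (simp add: gE fun_eq_iff)
      qed (use XS contS in auto)
      then have "(X has_real_derivative E x ^ 2) (at s)"
        using x by (simp add: has_field_derivative_def)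
      moreover have "X s = x" using XS x by auto
      ultimately show ?thesis by (simp add: has_field_derivative_at_within)
    qed
  qed
qed

text \<open>
  For \<open>a = E\<^sup>4\<close> the first-order terms produced by \<open>d/ds = E\<^sup>2 d/dx\<close> cancel exactly when the unknown is
  \<open>u / E\<close>; what is left over is the term \<open>E\<^sup>3 E''\<close> in the potential.
\<close>

lemma solves_liouville:
  assumes u: "continuous_on ({0..T} \<times> {0..l}) (\<lambda>q. u (fst q) (snd q))"
    and ux: "continuous_on ({0..T} \<times> {0..l}) (\<lambda>q. ux (fst q) (snd q))"
    and ut: "continuous_on ({0..T} \<times> {0..l}) (\<lambda>q. ut (fst q) (snd q))"
    and du: "\<And>t x. t \<in> {0..T} \<Longrightarrow> x \<in> {0..l} \<Longrightarrow> (u t has_vector_derivative ux t x) (at x within {0..l})"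
    and dux: "\<And>t x. t \<in> {0..T} \<Longrightarrow> x \<in> {0..l} \<Longrightarrow> (ux t has_vector_derivative uxx t x) (at x within {0..l})"
    and dut: "\<And>t x. t \<in> {0..T} \<Longrightarrow> x \<in> {0..l} \<Longrightarrow> ((\<lambda>s. u s x) has_vector_derivative ut t x) (at t within {0..T})"
    and pde: "\<And>t x. t \<in> {0..T} \<Longrightarrow> x \<in> {0..l} \<Longrightarrow> \<sigma> * ut t x = of_real (a x) * uxx t x - p x * u t x"
    and E_pos: "\<And>x. x \<in> {0..l} \<Longrightarrow> 0 < E x" and E4: "\<And>x. x \<in> {0..l} \<Longrightarrow> E x ^ 4 = a x"
    and dE: "\<And>x. x \<in> {0..l} \<Longrightarrow> (E has_real_derivative E\<^sub>1 x) (at x within {0..l})"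
    and dE1: "\<And>x. x \<in> {0..l} \<Longrightarrow> (E\<^sub>1 has_real_derivative E\<^sub>2 x) (at x within {0..l})"
    and X: "\<And>s. s \<in> {0..L} \<Longrightarrow> X s \<in> {0..l}"
    and dX: "\<And>s. s \<in> {0..L} \<Longrightarrow> (X has_real_derivative E (X s) ^ 2) (at s within {0..L})"
  shows "solves \<sigma> T L (\<lambda>s. p (X s) - of_real (E (X s) ^ 3 * E\<^sub>2 (X s)))
    (\<lambda>t s. (1 / E (X s)) *\<^sub>R u t (X s))
    (\<lambda>t s. E (X s) *\<^sub>R ux t (X s) - E\<^sub>1 (X s) *\<^sub>R u t (X s))
    (\<lambda>t s. (1 / E (X s)) *\<^sub>R ut t (X s))"
proof -
  have E: "continuous_on {0..l} E" "continuous_on {0..l} E\<^sub>1"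
    by (rule DERIV_continuous_on, erule dE dE1)+
  have Xc: "continuous_on {0..L} X" by (rule DERIV_continuous_on, erule dX)
  have X2: "continuous_on ({0..T} \<times> {0..L}) (\<lambda>q. X (snd q))"
    by (rule continuous_on_compose2 [OF Xc]) (auto intro: continuous_intros)
  have comp1: "continuous_on ({0..T} \<times> {0..L}) (\<lambda>q. f (X (snd q)))"
    if "continuous_on {0..l} f" for f :: "real \<Rightarrow> real"
    by (rule continuous_on_compose2 [OF that X2]) (use X in auto)
  have comp2: "continuous_on ({0..T} \<times> {0..L}) (\<lambda>q. f (fst q) (X (snd q)))"
    if "continuous_on ({0..T} \<times> {0..l}) (\<lambda>q. f (fst q) (snd q))" for f :: "real \<Rightarrow> real \<Rightarrow> complex"
  proof -
    have "continuous_on ({0..T} \<times> {0..L}) (\<lambda>q. (fst q, X (snd q)))"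
      by (intro continuous_intros X2)
    then show ?thesis
      using continuous_on_compose2 [OF that, of "{0..T} \<times> {0..L}" "\<lambda>q. (fst q, X (snd q))"] X by force
  qed
  have chain: "((\<lambda>s. f (X s)) has_vector_derivative E (X s) ^ 2 *\<^sub>R f') (at s within {0..L})"
    if "s \<in> {0..L}" "(f has_vector_derivative f') (at (X s) within {0..l})" for f :: "real \<Rightarrow> complex" and f' s
  proof -
    have "(f has_vector_derivative f') (at (X s) within X ` {0..L})"
      by (rule has_vector_derivative_within_subset [OF that(2)]) (use X in auto)
    from vector_diff_chain_within [OF _ this] dX [OF that(1)] show ?thesis
      by (simp add: o_def has_real_derivative_iff_has_vector_derivative)
  qed
  have inv_ne: "E (X (snd q)) \<noteq> 0" if "q \<in> {0..T} \<times> {0..L}" for q :: "real \<times> real"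
    using E_pos [OF X, of "snd q"] that by auto
  show ?thesis
    unfolding solves_def
  proof (intro conjI ballI)
    show "continuous_on ({0..T} \<times> {0..L}) (\<lambda>q. (1 / E (X (snd q))) *\<^sub>R u (fst q) (X (snd q)))"
      "continuous_on ({0..T} \<times> {0..L}) (\<lambda>q. (1 / E (X (snd q))) *\<^sub>R ut (fst q) (X (snd q)))"
      using inv_ne by (intro continuous_on_scaleR continuous_on_divide continuous_on_const comp1 E comp2 u ut; blast)+
    show "continuous_on ({0..T} \<times> {0..L}) (\<lambda>q. E (X (snd q)) *\<^sub>R ux (fst q) (X (snd q)) - E\<^sub>1 (X (snd q)) *\<^sub>R u (fst q) (X (snd q)))"
      by (intro continuous_on_scaleR continuous_on_diff comp1 E comp2 u ux)
  next
    fix t s assume t: "t \<in> {0..T}" and s: "s \<in> {0..L}"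
    define x where "x = X s"
    have x: "x \<in> {0..l}" using X [OF s] by (simp add: x_def)
    have Ex: "0 < E x" by (rule E_pos [OF x])
    have "((\<lambda>x. (1 / E x) *\<^sub>R u t x) has_vector_derivative
        (1 / E x) *\<^sub>R ux t x + (- E\<^sub>1 x / E x ^ 2) *\<^sub>R u t x) (at x within {0..l})"
      by (rule has_vector_derivative_scaleR [OF _ du [OF t x]])
         (use Ex in \<open>auto intro!: derivative_eq_intros dE [OF x] simp: power2_eq_square\<close>)
    from chain [OF s this [unfolded x_def]]
    show "((\<lambda>s. (1 / E (X s)) *\<^sub>R u t (X s)) has_vector_derivative
        E (X s) *\<^sub>R ux t (X s) - E\<^sub>1 (X s) *\<^sub>R u t (X s)) (at s within {0..L})"
      using Ex unfolding x_def by (simp add: scaleR_diff_right power2_eq_square)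
    have "((\<lambda>x. E x *\<^sub>R ux t x - E\<^sub>1 x *\<^sub>R u t x) has_vector_derivative
        (E x *\<^sub>R uxx t x + E\<^sub>1 x *\<^sub>R ux t x) - (E\<^sub>1 x *\<^sub>R ux t x + E\<^sub>2 x *\<^sub>R u t x)) (at x within {0..l})"
      by (intro has_vector_derivative_diff has_vector_derivative_scaleR dE dE1 du dux t x)
    from chain [OF s this [unfolded x_def]]
    have D: "((\<lambda>s. E (X s) *\<^sub>R ux t (X s) - E\<^sub>1 (X s) *\<^sub>R u t (X s)) has_vector_derivative
        E x ^ 2 *\<^sub>R (E x *\<^sub>R uxx t x - E\<^sub>2 x *\<^sub>R u t x)) (at s within {0..L})"
      unfolding x_def by simp
    define z where "z = complex_of_real (E x)"
    have z: "z \<noteq> 0" using Ex by (simp add: z_def)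
    have "z ^ 4 * uxx t x = \<sigma> * ut t x + p x * u t x"
      using pde [OF t x] E4 [OF x] by (simp add: z_def flip: of_real_power)
    then have "z * (z ^ 2 * (z * uxx t x - of_real (E\<^sub>2 x) * u t x))
        = \<sigma> * ut t x + (p x - z ^ 3 * of_real (E\<^sub>2 x)) * u t x"
      by algebra
    then have "z ^ 2 * (z * uxx t x - of_real (E\<^sub>2 x) * u t x)
        = \<sigma> * (1 / z * ut t x) + (p x - z ^ 3 * of_real (E\<^sub>2 x)) * (1 / z * u t x)"
      using z by (simp add: field_simps)
    then have "E x ^ 2 *\<^sub>R (E x *\<^sub>R uxx t x - E\<^sub>2 x *\<^sub>R u t x)
        = \<sigma> * ((1 / E x) *\<^sub>R ut t x) + (p x - of_real (E x ^ 3 * E\<^sub>2 x)) * ((1 / E x) *\<^sub>R u t x)"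
      by (simp add: scaleR_conv_of_real z_def)
    with D show "((\<lambda>s. E (X s) *\<^sub>R ux t (X s) - E\<^sub>1 (X s) *\<^sub>R u t (X s)) has_vector_derivative
        \<sigma> * ((1 / E (X s)) *\<^sub>R ut t (X s)) +
        (p (X s) - of_real (E (X s) ^ 3 * E\<^sub>2 (X s))) * ((1 / E (X s)) *\<^sub>R u t (X s))) (at s within {0..L})"
      unfolding x_def by simp
    show "((\<lambda>r. (1 / E (X s)) *\<^sub>R u r (X s)) has_vector_derivative (1 / E (X s)) *\<^sub>R ut t (X s)) (at t within {0..T})"
      using dut [OF t x] unfolding x_def
      by (rule bounded_linear.has_vector_derivative [OF bounded_linear_scaleR_right])
  qed
qed

lemma zero_on_closed_interval:
  fixes f :: "real \<Rightarrow> complex"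
  assumes "continuous_on {a..b} f" "\<And>x. x \<in> {a<..<b} \<Longrightarrow> f x = 0" "a < b" "x \<in> {a..b}"
  shows "f x = 0"
  by (rule continuous_constant_on_closure [of "{a<..<b}" f]) (use assms in auto)

lemma C_1_2_onD:
  assumes "C_1_2_on I J u" "t \<in> I" "x \<in> J"
  shows "(u t has_vector_derivative partial_x J u t x) (at x within J)"
    and "(partial_x J u t has_vector_derivative partial_x J (partial_x J u) t x) (at x within J)"
    and "((\<lambda>s. u s x) has_vector_derivative partial_t I u t x) (at t within I)"
proof -
  have d: "(\<lambda>s. u s x) differentiable (at t within I)" "u t differentiable (at x within J)"
    "partial_x J u t differentiable (at x within J)"
    using assms unfolding C_1_2_on_def by auto
  show "(u t has_vector_derivative partial_x J u t x) (at x within J)"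
    using d(2) unfolding partial_x_def by (simp add: vector_derivative_works)
  show "((\<lambda>s. u s x) has_vector_derivative partial_t I u t x) (at t within I)"
    using d(1) unfolding partial_t_def by (simp add: vector_derivative_works)
  show "(partial_x J u t has_vector_derivative partial_x J (partial_x J u) t x) (at x within J)"
    using d(3) unfolding partial_x_def [of J "partial_x J u"] by (simp add: vector_derivative_works)
qed

lemma C_1_2_on_continuous:
  assumes "C_1_2_on I J u"
  shows "continuous_on (I \<times> J) (\<lambda>q. u (fst q) (snd q))"
    and "continuous_on (I \<times> J) (\<lambda>q. partial_x J u (fst q) (snd q))"
    and "continuous_on (I \<times> J) (\<lambda>q. partial_x J (partial_x J u) (fst q) (snd q))"
    and "continuous_on (I \<times> J) (\<lambda>q. partial_t I u (fst q) (snd q))"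
  using assms by (auto simp: C_1_2_on_def split_beta)

lemma continuous_on_slice:
  assumes "continuous_on (I \<times> J) (\<lambda>q. F (fst q) (snd q))"
  shows "t \<in> I \<Longrightarrow> continuous_on J (\<lambda>x. F t x)" and "x \<in> J \<Longrightarrow> continuous_on I (\<lambda>t. F t x)"
proof -
  have "continuous_on J (\<lambda>x. (t, x))" "continuous_on I (\<lambda>t. (t, x))"
    by (intro continuous_on_Pair continuous_on_const continuous_on_id)+
  from this [THEN continuous_on_compose2 [OF assms]]
  show "t \<in> I \<Longrightarrow> continuous_on J (\<lambda>x. F t x)" and "x \<in> J \<Longrightarrow> continuous_on I (\<lambda>t. F t x)"
    by auto
qed

lemma equation_on_closed_rectangle:
  assumes T: "0 < T" and l: "0 < l" and u: "C_1_2_on {0..T} {0..l} u"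
    and a: "continuous_on {0..l} a" and p: "continuous_on {0..l} p"
    and pde: "\<forall>t\<in>{0<..<T}. \<forall>x\<in>{0<..<l}. \<sigma> * partial_t {0..T} u t x
        = of_real (a x) * partial_x {0..l} (partial_x {0..l} u) t x - p x * u t x"
    and t: "t \<in> {0..T}" and x: "x \<in> {0..l}"
  shows "\<sigma> * partial_t {0..T} u t x
        = of_real (a x) * partial_x {0..l} (partial_x {0..l} u) t x - p x * u t x"
proof -
  define D where "D q = \<sigma> * partial_t {0..T} u (fst q) (snd q)
     - (of_real (a (snd q)) * partial_x {0..l} (partial_x {0..l} u) (fst q) (snd q) - p (snd q) * u (fst q) (snd q))" for q
  have cl: "closure ({0<..<T} \<times> {0<..<l}) = {0..T} \<times> {0..l}"
    using T l by (simp add: closure_Times)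
  have snd: "continuous_on ({0..T} \<times> {0..l}) (\<lambda>q. f (snd q))"
    if "continuous_on {0..l} f" for f :: "real \<Rightarrow> 'b::topological_space"
    by (rule continuous_on_compose2 [OF that]) (auto intro: continuous_intros)
  have "continuous_on (closure ({0<..<T} \<times> {0<..<l})) D"
    unfolding cl D_def
    by (intro continuous_on_diff continuous_on_mult continuous_on_const continuous_on_of_real
        snd a p C_1_2_on_continuous [OF u])
  then have "D (t, x) = 0"
    by (rule continuous_constant_on_closure) (use pde t x cl in \<open>auto simp: D_def\<close>)
  then show ?thesis by (simp add: D_def)
qed

lemma C_k_on_Suc_continuous: "C_k_on (Suc k) f S \<Longrightarrow> continuous_on S f"
  by (auto simp: continuous_on_eq_continuous_within intro!: differentiable_imp_continuous_within)

theorem theorem1: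
  fixes l T :: real and \<sigma> :: complex
    and p q b :: "real \<Rightarrow> complex" and a :: "real \<Rightarrow> real"
    and u v :: "real \<Rightarrow> real \<Rightarrow> complex"
  assumes "l > 0" and "T > 0" and "\<sigma> \<noteq> 0"
    and "C_k_on 1 p {0..l}" and "C_k_on 1 q {0..l}"
    and "C_k_on 2 a {0..l}" and "\<forall>x\<in>{0..l}. a x > 0"
    and "C_k_on 3 b {0..l}"
    and "finite {x\<in>{0..l}. b x = 0}"
    and "\<forall>x\<in>{0..l}. b x = 0 \<longrightarrow> vector_derivative b (at x within {0..l}) \<noteq> 0"
    and "C_1_2_on {0..T} {0..l} u" and "C_1_2_on {0..T} {0..l} v"
    and "\<forall>t\<in>{0<..<T}. \<forall>x\<in>{0<..<l}.
      \<sigma> * partial_t {0..T} u t x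
        = of_real (a x) * partial_x {0..l} (partial_x {0..l} u) t x - p x * u t x"
    and "\<forall>t\<in>{0<..<T}. \<forall>x\<in>{0<..<l}.
      \<sigma> * partial_t {0..T} v t x
        = of_real (a x) * partial_x {0..l} (partial_x {0..l} v) t x - q x * v t x"
    and "(\<forall>x\<in>{0<..<l}. u 0 x = b x \<and> v 0 x = b x) \<or>
      (\<forall>x\<in>{0<..<l}. u T x = b x \<and> v T x = b x)"
    and "\<forall>t\<in>{0<..<T}. u t 0 = v t 0"
    and "\<forall>t\<in>{0<..<T}. partial_x {0..l} u t 0 = partial_x {0..l} v t 0"
  shows "((\<forall>t\<in>{0<..<T}. partial_x {0..l} u t 0 = 0 \<and> partial_x {0..l} v t 0 = 0)
          \<longrightarrow> (\<forall>x\<in>{0..l}. p x = q x))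
       \<and> ((\<exists>\<epsilon>\<in>{0<..<l}. \<forall>x\<in>{0..\<epsilon>}. p x = q x)
          \<longrightarrow> (\<forall>x\<in>{0..l}. p x = q x))"
proof -
  note l = assms(1) and T = assms(2)
  have p: "continuous_on {0..l} p" and q: "continuous_on {0..l} q"
    and a: "continuous_on {0..l} a" and b: "continuous_on {0..l} b"
    using C_k_on_Suc_continuous assms(4-6,8) by (metis One_nat_def numeral_2_eq_2 numeral_3_eq_3)+
  note u = assms(11) and v = assms(12)
  let ?ux = "partial_x {0..l} u" and ?vx = "partial_x {0..l} v"
  note cu = C_1_2_on_continuous [OF u] and cv = C_1_2_on_continuous [OF v]
  have 0: "(0::real) \<in> {0..l}" using l by simp
  obtain t\<^sub>0 where t\<^sub>0: "t\<^sub>0 \<in> {0..T}"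
    and init: "\<And>x. x \<in> {0<..<l} \<Longrightarrow> u t\<^sub>0 x = b x \<and> v t\<^sub>0 x = b x"
    using assms(15) T by (metis atLeastAtMost_iff less_imp_le order_refl)
  have ub: "u t\<^sub>0 x = b x" and vb: "v t\<^sub>0 x = b x" if x: "x \<in> {0..l}" for x
    using zero_on_closed_interval [of 0 l "\<lambda>x. u t\<^sub>0 x - b x" x]
      zero_on_closed_interval [of 0 l "\<lambda>x. v t\<^sub>0 x - b x" x]
      continuous_on_diff [OF continuous_on_slice(1) [OF cu(1) t\<^sub>0] b]
      continuous_on_diff [OF continuous_on_slice(1) [OF cv(1) t\<^sub>0] b] init l x by auto
  have lat: "u t 0 = v t 0" and latx: "?ux t 0 = ?vx t 0" if t: "t \<in> {0..T}" for t
    using zero_on_closed_interval [of 0 T "\<lambda>t. u t 0 - v t 0" t]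
      zero_on_closed_interval [of 0 T "\<lambda>t. ?ux t 0 - ?vx t 0" t]
      continuous_on_diff [OF continuous_on_slice(2) [OF cu(1) 0] continuous_on_slice(2) [OF cv(1) 0]]
      continuous_on_diff [OF continuous_on_slice(2) [OF cu(2) 0] continuous_on_slice(2) [OF cv(2) 0]]
      assms(16,17) T t by auto
  have simple: "?ux t\<^sub>0 x \<noteq> 0" if x: "x \<in> {0..l}" and z: "u t\<^sub>0 x = 0" for x
  proof -
    have "(b has_vector_derivative ?ux t\<^sub>0 x) (at x within {0..l})"
      by (rule has_vector_derivative_transform [OF x _ C_1_2_onD(1) [OF u t\<^sub>0 x]]) (simp add: ub)
    then have "vector_derivative b (at x within {0..l}) = ?ux t\<^sub>0 x"
      using vector_derivative_within_closed_interval l x by blast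
    then show ?thesis using assms(10) x z ub by auto
  qed
  obtain E E\<^sub>1 E\<^sub>2 where E_pos: "\<And>x. x \<in> {0..l} \<Longrightarrow> 0 < E x"
    and E4: "\<And>x. x \<in> {0..l} \<Longrightarrow> E x ^ 4 = a x"
    and dE: "\<And>x. x \<in> {0..l} \<Longrightarrow> (E has_real_derivative E\<^sub>1 x) (at x within {0..l})"
    and dE1: "\<And>x. x \<in> {0..l} \<Longrightarrow> (E\<^sub>1 has_real_derivative E\<^sub>2 x) (at x within {0..l})"
    and E2: "continuous_on {0..l} E\<^sub>2"
    using fourth_root_C2 [OF assms(6)] assms(7) by metis
  have E: "continuous_on {0..l} E" by (rule DERIV_continuous_on, erule dE)
  obtain L X where L: "0 < L" and X0: "X 0 = 0" and XL: "X L = l"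
    and X: "\<And>s. s \<in> {0..L} \<Longrightarrow> X s \<in> {0..l}"
    and X_onto: "\<And>x. x \<in> {0..l} \<Longrightarrow> \<exists>s\<in>{0..L}. X s = x"
    and X_mono: "\<And>s s'. s \<in> {0..L} \<Longrightarrow> s' \<in> {0..L} \<Longrightarrow> s \<le> s' \<Longrightarrow> X s \<le> X s'"
    and dX: "\<And>s. s \<in> {0..L} \<Longrightarrow> (X has_real_derivative E (X s) ^ 2) (at s within {0..L})"
    by (rule travel_time_coordinate [OF l E E_pos]) (assumption, rule that)
  have Xc: "continuous_on {0..L} X" by (rule DERIV_continuous_on, erule dX)
  have XE: "continuous_on {0..L} (\<lambda>s. f (X s))" if "continuous_on {0..l} f" for f :: "real \<Rightarrow> 'b::topological_space"
    by (rule continuous_on_compose2 [OF that Xc]) (use X in auto)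
  define P where "P s = p (X s) - of_real (E (X s) ^ 3 * E\<^sub>2 (X s))" for s
  define Q where "Q s = q (X s) - of_real (E (X s) ^ 3 * E\<^sub>2 (X s))" for s
  define U where "U t s = (1 / E (X s)) *\<^sub>R u t (X s)" for t s
  define V where "V t s = (1 / E (X s)) *\<^sub>R v t (X s)" for t s
  define Ux where "Ux t s = E (X s) *\<^sub>R ?ux t (X s) - E\<^sub>1 (X s) *\<^sub>R u t (X s)" for t s
  define Vx where "Vx t s = E (X s) *\<^sub>R ?vx t (X s) - E\<^sub>1 (X s) *\<^sub>R v t (X s)" for t s
  have PQ: "continuous_on {0..L} P" "continuous_on {0..L} Q"
    unfolding P_def Q_def by (intro continuous_intros XE p q E E2)+
  have sU: "solves \<sigma> T L P U Ux (\<lambda>t s. (1 / E (X s)) *\<^sub>R partial_t {0..T} u t (X s))"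
    unfolding P_def U_def Ux_def
    by (rule solves_liouville [OF cu(1,2,4) C_1_2_onD [OF u]
          equation_on_closed_rectangle [OF T l u a p assms(13)] E_pos E4 dE dE1 X dX])
  have sV: "solves \<sigma> T L Q V Vx (\<lambda>t s. (1 / E (X s)) *\<^sub>R partial_t {0..T} v t (X s))"
    unfolding Q_def V_def Vx_def
    by (rule solves_liouville [OF cv(1,2,4) C_1_2_onD [OF v]
          equation_on_closed_rectangle [OF T l v a q assms(14)] E_pos E4 dE dE1 X dX])
  have main: "p x = q x" if x: "x \<in> {0..l}"
    and start: "(\<exists>\<beta>. \<forall>t\<in>{0..T}. Ux t 0 = \<beta> * U t 0) \<or> (\<exists>\<epsilon>\<in>{0<..<L}. \<forall>s\<in>{0..\<epsilon>}. P s = Q s)" for x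
  proof -
    obtain s where s: "s \<in> {0..L}" "X s = x" using X_onto [OF x] by blast
    have "P s = Q s"
    proof (rule potentials_eq_unit_speed [OF L T t\<^sub>0 PQ sU sV _ _ _ start s(1)])
      show "U t 0 = V t 0 \<and> Ux t 0 = Vx t 0" if "t \<in> {0..T}" for t
        using lat [OF that] latx [OF that] by (simp add: U_def V_def Ux_def Vx_def X0)
      show "U t\<^sub>0 x = V t\<^sub>0 x" if "x \<in> {0..L}" for x
        using ub vb X [OF that] by (simp add: U_def V_def)
      show "Ux t\<^sub>0 x \<noteq> 0" if "x \<in> {0..L}" "U t\<^sub>0 x = 0" for x
        using simple [OF X [OF that(1)]] E_pos [OF X [OF that(1)]] that(2)
        by (auto simp: U_def Ux_def)
    qed
    then show ?thesis using s by (simp add: P_def Q_def)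
  qed
  show ?thesis
  proof (intro conjI impI)
    assume A: "\<forall>t\<in>{0<..<T}. ?ux t 0 = 0 \<and> ?vx t 0 = 0"
    have ux0: "?ux t 0 = 0" if "t \<in> {0..T}" for t
      using zero_on_closed_interval [OF continuous_on_slice(2) [OF cu(2) 0] _ T that] A by auto
    \<comment> \<open>a Neumann condition for \<open>u\<close> is a Robin condition for \<open>u / E\<close>\<close>
    have "\<forall>t\<in>{0..T}. Ux t 0 = of_real (- E\<^sub>1 0 * E 0) * U t 0"
      using ux0 E_pos [OF 0] by (simp add: Ux_def U_def X0 scaleR_conv_of_real)
    then show "\<forall>x\<in>{0..l}. p x = q x" using main by blast
  next
    assume "\<exists>\<epsilon>\<in>{0<..<l}. \<forall>x\<in>{0..\<epsilon>}. p x = q x"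
    then obtain \<epsilon> where \<epsilon>: "0 < \<epsilon>" "\<epsilon> < l" "\<And>x. x \<in> {0..\<epsilon>} \<Longrightarrow> p x = q x" by auto
    obtain r where r: "r \<in> {0..L}" "X r = \<epsilon>" using X_onto [of \<epsilon>] \<epsilon> by auto
    have "r \<noteq> 0" "r \<noteq> L" using r \<epsilon> X0 XL by auto
    then have "r \<in> {0<..<L}" using r by auto
    moreover have "\<forall>s\<in>{0..r}. P s = Q s"
    proof
      fix s assume s: "s \<in> {0..r}"
      then have "X s \<in> {0..\<epsilon>}" using X_mono [of s r] X [of s] r by auto
      then show "P s = Q s" using \<epsilon>(3) by (simp add: P_def Q_def)
    qed
    ultimately show "\<forall>x\<in>{0..l}. p x = q x" using main by blast
  qed
qed

end
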